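(* Let $1<k\le n$ and let $J\subseteq C(n,k)$ be a realizable $k$-set. The poset $(\overline{\mathrm{Paths}}_{k-1}(\emptyset,J),\le_{\mathrm{MS}})$ has a unique minimal element $r_{\min}$ and a unique maximal element $r_{\max}$. These are determined by their inversion sets, which are $\mathrm{Inv}(r_{\min})=J_s$ and $\mathrm{Inv}(r_{\max})=J_s\cup J_F$.
   Context: $C(n,k)$: $k$-subsets of $\{1,\dots,n\}$, lexicographic order on increasing sequences, antilexicographic = reverse. For $X\in C(n,k+1)$, $P_X=\{Y\in C(n,k):Y\subset X\}$ with lexicographic order; prefix/suffix = initial/final segment (possibly empty or all). For $A\subseteq C(n,k)$: $A_p$ (resp. $A_s$) = $\{X\in C(n,k+1):P_X\cap A$ a nonempty prefix (resp. suffix) of $P_X$, $\ne P_X\}$, $A_F=\{X:P_X\subseteq A\}$, $A_\emptyset=\{X:P_X\cap A=\emptyset\}$; $A$ is realizable if each $P_X\cap A$ is a prefix or suffix of $P_X$. A path from $\emptyset$ to $J$ in $B(n,k-1)$ is a total order $\gamma$ on $J$ every prefix of which is a realizable subset of $C(n,k)$. $\mathrm{Inv}(\gamma)=J_s\cup\{X\in J_F:\gamma|_{P_X}\text{ antilexicographic}\}$. Paths are elementarily equivalent if they differ by swapping two adjacent elements not in a common $k$-packet; $\sim$ is the generated equivalence, and $\overline{\mathrm{Paths}}_{k-1}(\emptyset,J)$ the set of classes. For $X\in J_F$ with $P_X$ contiguous in a representative of $r$, $p_X(r)$ reverses that block. $r\le_{\mathrm{MS}}r'$ iff $r'$ is reached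 from $r$ by a sequence of flips $p_{X_j}$ with $X_j\in J_F$ and $X_j\notin\mathrm{Inv}$ of the current class. *)

theory Defs
  imports Main
begin

definition ksubsets :: "nat \<Rightarrow> nat \<Rightarrow> nat set set" where
  "ksubsets n k = {Y. Y \<subseteq> {1..n} \<and> card Y = k}"

definition lex_less :: "nat set \<Rightarrow> nat set \<Rightarrow> bool" where
  "lex_less Y Z \<longleftrightarrow> (sorted_list_of_set Y, sorted_list_of_set Z) \<in> lexord {(a, b). a < b}"

definition packet :: "nat \<Rightarrow> nat \<Rightarrow> nat set \<Rightarrow> nat set set" where
  "packet n k X = {Y \<in> ksubsets n k. Y \<subset> X}"

text \<open>Prefixes and suffixes are the initial and final segments of the lexicographic order;
  the empty set and the whole of \<open>T\<close> are allowed.\<close>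

definition lex_prefix :: "nat set set \<Rightarrow> nat set set \<Rightarrow> bool" where
  "lex_prefix S T \<longleftrightarrow> S \<subseteq> T \<and> (\<forall>Y\<in>S. \<forall>Z\<in>T. lex_less Z Y \<longrightarrow> Z \<in> S)"

definition lex_suffix :: "nat set set \<Rightarrow> nat set set \<Rightarrow> bool" where
  "lex_suffix S T \<longleftrightarrow> S \<subseteq> T \<and> (\<forall>Y\<in>S. \<forall>Z\<in>T. lex_less Y Z \<longrightarrow> Z \<in> S)"

definition suffix_packets :: "nat \<Rightarrow> nat \<Rightarrow> nat set set \<Rightarrow> nat set set" where
  "suffix_packets n k A = {X \<in> ksubsets n (k + 1).
     lex_suffix (packet n k X \<inter> A) (packet n k X) \<and>
     packet n k X \<inter> A \<noteq> {} \<and> packet n k X \<inter> A \<noteq> packet n k X}"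

definition full_packets :: "nat \<Rightarrow> nat \<Rightarrow> nat set set \<Rightarrow> nat set set" where
  "full_packets n k A = {X \<in> ksubsets n (k + 1). packet n k X \<subseteq> A}"

definition realizable :: "nat \<Rightarrow> nat \<Rightarrow> nat set set \<Rightarrow> bool" where
  "realizable n k A \<longleftrightarrow> A \<subseteq> ksubsets n k \<and>
     (\<forall>X\<in>ksubsets n (k + 1).
        lex_prefix (packet n k X \<inter> A) (packet n k X) \<or>
        lex_suffix (packet n k X \<inter> A) (packet n k X))"

text \<open>A total order on the finite set \<open>J\<close> is represented by the list of the elements of \<open>J\<close>
  in increasing order, each occurring once.\<close>

definition paths :: "nat \<Rightarrow> nat \<Rightarrow> nat set set \<Rightarrow> nat set list set" where
  "paths n k J = {\<gamma>. distinct \<gamma> \<and> set \<gamma> = J \<and> (\<forall>i\<le>length \<gamma>. realizable n k (set (take i \<gamma>)))}"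

definition inversions :: "nat \<Rightarrow> nat \<Rightarrow> nat set set \<Rightarrow> nat set list \<Rightarrow> nat set set" where
  "inversions n k J \<gamma> = suffix_packets n k J \<union>
     {X \<in> full_packets n k J.
        sorted_wrt (\<lambda>Y Z. lex_less Z Y) (filter (\<lambda>Y. Y \<in> packet n k X) \<gamma>)}"

definition elem_equiv :: "nat \<Rightarrow> nat \<Rightarrow> nat set set \<Rightarrow> nat set list \<Rightarrow> nat set list \<Rightarrow> bool" where
  "elem_equiv n k J \<gamma> \<gamma>' \<longleftrightarrow> \<gamma> \<in> paths n k J \<and> \<gamma>' \<in> paths n k J \<and>
     (\<exists>xs Y Z ys. \<gamma> = xs @ [Y, Z] @ ys \<and> \<gamma>' = xs @ [Z, Y] @ ys \<and>
        \<not> (\<exists>X\<in>ksubsets n (k + 1). Y \<in> packet n k X \<and> Z \<in> packet n k X))"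

definition path_equiv :: "nat \<Rightarrow> nat \<Rightarrow> nat set set \<Rightarrow> (nat set list \<times> nat set list) set" where
  "path_equiv n k J = {(\<gamma>, \<gamma>'). \<gamma> \<in> paths n k J \<and> \<gamma>' \<in> paths n k J \<and>
     equivclp (elem_equiv n k J) \<gamma> \<gamma>'}"

definition path_classes :: "nat \<Rightarrow> nat \<Rightarrow> nat set set \<Rightarrow> nat set list set set" where
  "path_classes n k J = paths n k J // path_equiv n k J"

lemma equiv_path_equiv: "equiv (paths n k J) (path_equiv n k J)"
proof (rule equivI)
  show "path_equiv n k J \<subseteq> paths n k J \<times> paths n k J"
    by (auto simp: path_equiv_def)
  show "refl_on (paths n k J) (path_equiv n k J)"
    by (auto simp: refl_on_def path_equiv_def)
  show "sym (path_equiv n k J)"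
    by (auto simp: sym_def path_equiv_def intro: equivclp_sym)
  show "trans (path_equiv n k J)"
    by (auto simp: trans_def path_equiv_def intro: equivclp_trans)
qed

lemma inversions_elem_equiv:
  assumes "elem_equiv n k J \<gamma> \<gamma>'"
  shows "inversions n k J \<gamma> = inversions n k J \<gamma>'"
proof -
  have "filter (\<lambda>Y. Y \<in> packet n k X) \<gamma> = filter (\<lambda>Y. Y \<in> packet n k X) \<gamma>'"
    if "X \<in> ksubsets n (k + 1)" for X
    using assms that by (auto simp: elem_equiv_def)
  then show ?thesis
    by (auto simp: inversions_def full_packets_def)
qed

lemma inversions_path_equiv:
  assumes "(\<gamma>, \<gamma>') \<in> path_equiv n k J"
  shows "inversions n k J \<gamma> = inversions n k J \<gamma>'"
proof -
  have "equivclp (elem_equiv n k J) \<gamma> \<gamma>'"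
    using assms by (simp add: path_equiv_def)
  then show ?thesis
    by (induction rule: equivclp_induct) (auto dest: inversions_elem_equiv)
qed

definition class_inversions :: "nat \<Rightarrow> nat \<Rightarrow> nat set set \<Rightarrow> nat set list set \<Rightarrow> nat set set" where
  "class_inversions n k J r = the_elem (inversions n k J ` r)"

lemma class_inversions_eq:
  assumes "r \<in> path_classes n k J" "\<gamma> \<in> r"
  shows "class_inversions n k J r = inversions n k J \<gamma>"
proof -
  have "(\<gamma>, \<gamma>') \<in> path_equiv n k J" if "\<gamma>' \<in> r" for \<gamma>'
    using quotient_eq_iff[OF equiv_path_equiv] assms that
    unfolding path_classes_def by blast
  then have "inversions n k J ` r = {inversions n k J \<gamma>}"
    using assms(2) by (auto dest: inversions_path_equiv)
  then show ?thesis
    by (simp add: class_inversions_def)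
qed

text \<open>\<open>flip n k J X r r'\<close> is the graph of the partial map \<open>p\<^sub>X\<close>: it says that \<open>r' = p\<^sub>X(r)\<close>.
  The representative of \<open>r\<close> is the list in which \<open>P\<^sub>X\<close> occupies the block \<open>bs\<close>.\<close>

definition flip ::
  "nat \<Rightarrow> nat \<Rightarrow> nat set set \<Rightarrow> nat set \<Rightarrow> nat set list set \<Rightarrow> nat set list set \<Rightarrow> bool" where
  "flip n k J X r r' \<longleftrightarrow>
     X \<in> full_packets n k J \<and> r \<in> path_classes n k J \<and> r' \<in> path_classes n k J \<and>
     (\<exists>xs bs ys. xs @ bs @ ys \<in> r \<and> set bs = packet n k X \<and> xs @ rev bs @ ys \<in> r')"

definition ms_order :: "nat \<Rightarrow> nat \<Rightarrow> nat set set \<Rightarrow> nat set list set rel" where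
  "ms_order n k J = {(r, r'). r \<in> path_classes n k J \<and> r' \<in> path_classes n k J \<and>
     (\<lambda>s s'. \<exists>X. flip n k J X s s' \<and> X \<notin> class_inversions n k J s)\<^sup>*\<^sup>* r r'}"

definition minimal_elements :: "'a set \<Rightarrow> 'a rel \<Rightarrow> 'a set" where
  "minimal_elements P le = {m \<in> P. \<forall>x\<in>P. (x, m) \<in> le \<longrightarrow> x = m}"

definition maximal_elements :: "'a set \<Rightarrow> 'a rel \<Rightarrow> 'a set" where
  "maximal_elements P le = {m \<in> P. \<forall>x\<in>P. (m, x) \<in> le \<longrightarrow> x = m}"

end

theory Submission
  imports Defs "HOL-Library.Ramsey"
begin

text \<open>
  A set \<open>I\<close> of \<open>(k+1)\<close>-sets orients every \<open>k\<close>-packet: antilexicographically on the packets of the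
  elements of \<open>I\<close>, lexicographically on the others. If \<open>I\<close> is realizable, the resulting relation on the
  \<open>k\<close>-sets is acyclic, by induction on the ground set: with \<open>t\<close> the largest element and
  \<open>K = {Y. insert t Y \<in> I}\<close>, no arc leads backwards in the partition into the \<open>k\<close>-sets outside \<open>K\<close>
  avoiding \<open>t\<close>, the \<open>k\<close>-sets containing \<open>t\<close>, and the \<open>k\<close>-sets in \<open>K\<close> avoiding \<open>t\<close>, and each part
  inherits the relation of a smaller ground set.

  The classes of paths to \<open>J\<close> correspond to the traces on \<open>J\<^sub>F\<close> of the realizable \<open>I\<close> for which \<open>J\<close> is
  an initial set of the relation, a class consisting of the linear extensions on \<open>J\<close>. The sets
  \<open>{X. X - {max X} \<notin> J}\<close> and \<open>{X. X - {min X} \<in> J}\<close> are such \<open>I\<close>; they have trace \<open>\<emptyset>\<close> and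
  \<open>J\<^sub>F\<close>. If \<open>I\<close> meets \<open>J\<^sub>F\<close>, some \<open>X \<in> I \<inter> J\<^sub>F\<close> can be removed from \<open>I\<close> with the result still realizable.
  Acyclicity for both \<open>I\<close> and \<open>I - {X}\<close> yields a linear extension in which the packet of \<open>X\<close> is
  contiguous, that is, a downward flip. Reversing the order of the ground set gives upward flips.
\<close>


section \<open>Sets of fixed size under removal and insertion of an element\<close>

lemma nsets_remove: "X \<in> nsets V (Suc k) \<Longrightarrow> a \<in> X \<Longrightarrow> X - {a} \<in> nsets V k"
  by (auto simp: nsets_def card_Diff_singleton)

lemma nsets_insert: "X \<in> nsets V k \<Longrightarrow> finite V \<Longrightarrow> t \<notin> V \<Longrightarrow> insert t X \<in> nsets (insert t V) (Suc k)"
  by (auto simp: nsets_def card_insert_if finite_subset)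

lemma nsets_insertE:
  assumes "X \<in> nsets (insert t V) k"
  obtains "t \<notin> X" "X \<in> nsets V k" | X' k' where "k = Suc k'" "X = insert t X'" "t \<notin> X'" "X' \<in> nsets V k'"
proof (cases "t \<in> X")
  case False
  then show ?thesis using assms that(1) by (auto simp: nsets_def)
next
  case True
  moreover have "finite X" using assms by (simp add: nsets_def)
  ultimately have "Suc (card (X - {t})) = card X" by (metis card_Suc_Diff1)
  then have "k = Suc (card (X - {t}))" "X - {t} \<in> nsets V (card (X - {t}))"
    using assms by (auto simp: nsets_def)
  then show ?thesis using that(2)[of "card (X - {t})" "X - {t}"] True by auto
qed

section \<open>Realizable sets and the arc relation over a linear order\<close>

context linorder
begin

text \<open>\<open>consistent\<close> expresses realizability by forbidden alternations in packets. It and the relation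
  \<open>arc\<close> are set up in the class context so that they can be instantiated with the reversed order.\<close>

definition consistent :: "'a set \<Rightarrow> nat \<Rightarrow> 'a set set \<Rightarrow> bool" where
  "consistent V k I \<longleftrightarrow> (\<forall>W\<in>nsets V (Suc k). \<forall>a\<in>W. \<forall>b\<in>W. \<forall>c\<in>W. a < b \<longrightarrow> b < c \<longrightarrow>
     (W - {a} \<in> I \<longleftrightarrow> W - {c} \<in> I) \<longrightarrow> (W - {b} \<in> I \<longleftrightarrow> W - {a} \<in> I))"

definition arc :: "'a set \<Rightarrow> nat \<Rightarrow> 'a set set \<Rightarrow> 'a set \<Rightarrow> 'a set \<Rightarrow> bool" where
  "arc V k I Y Z \<longleftrightarrow> (\<exists>X\<in>nsets V (Suc k). \<exists>a\<in>X. \<exists>b\<in>X. a < b \<and>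
     (if X \<in> I then Y = X - {a} \<and> Z = X - {b} else Y = X - {b} \<and> Z = X - {a}))"

definition closed :: "'a set \<Rightarrow> nat \<Rightarrow> 'a set set \<Rightarrow> 'a set set \<Rightarrow> bool" where
  "closed V k I J \<longleftrightarrow> (\<forall>Y Z. arc V k I Y Z \<longrightarrow> Z \<in> J \<longrightarrow> Y \<in> J)"

lemma consistentD:
  assumes "consistent V k I" "W \<in> nsets V (Suc k)" "a \<in> W" "b \<in> W" "c \<in> W" "a < b" "b < c"
    "W - {a} \<in> I \<longleftrightarrow> W - {c} \<in> I"
  shows "W - {b} \<in> I \<longleftrightarrow> W - {a} \<in> I"
  using assms unfolding consistent_def by blast

lemma consistent_mono: "consistent V k I \<Longrightarrow> V' \<subseteq> V \<Longrightarrow> consistent V' k I"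
  unfolding consistent_def by (meson nsets_mono subsetD)

lemma consistent_Compl: "consistent V k (- I) \<longleftrightarrow> consistent V k I"
  unfolding consistent_def by auto

lemma arcI1: "X \<in> nsets V (Suc k) \<Longrightarrow> a \<in> X \<Longrightarrow> b \<in> X \<Longrightarrow> a < b \<Longrightarrow> X \<in> I \<Longrightarrow> arc V k I (X - {a}) (X - {b})"
  unfolding arc_def by (rule bexI[of _ X], rule bexI[of _ a], rule bexI[of _ b]) simp_all

lemma arcI2: "X \<in> nsets V (Suc k) \<Longrightarrow> a \<in> X \<Longrightarrow> b \<in> X \<Longrightarrow> a < b \<Longrightarrow> X \<notin> I \<Longrightarrow> arc V k I (X - {b}) (X - {a})"
  unfolding arc_def by (rule bexI[of _ X], rule bexI[of _ a], rule bexI[of _ b]) simp_all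

lemma arcE:
  assumes "arc V k I Y Z"
  obtains X a b where "X \<in> nsets V (Suc k)" "a \<in> X" "b \<in> X" "a < b" "X \<in> I" "Y = X - {a}" "Z = X - {b}"
    | X a b where "X \<in> nsets V (Suc k)" "a \<in> X" "b \<in> X" "a < b" "X \<notin> I" "Y = X - {b}" "Z = X - {a}"
  proof -
  obtain X a b where "X \<in> nsets V (Suc k)" "a \<in> X" "b \<in> X" "a < b"
    "if X \<in> I then Y = X - {a} \<and> Z = X - {b} else Y = X - {b} \<and> Z = X - {a}"
    using assms unfolding arc_def by blast
  then show thesis using that by (cases "X \<in> I") simp_all
qed

lemma arc_nsets: "arc V k I Y Z \<Longrightarrow> Y \<in> nsets V k \<and> Z \<in> nsets V k"
  by (erule arcE) (auto simp: nsets_remove)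

lemma arc_mono: "arc V k I Y Z \<Longrightarrow> V \<subseteq> V' \<Longrightarrow> arc V' k I Y Z"
  unfolding arc_def by (meson nsets_mono subsetD)

section \<open>Acyclicity of the arc relation\<close>

text \<open>Let \<open>X\<close> be the set whose packet carries the arc. Either \<open>X\<close>
  avoids \<open>t\<close>, or both ends keep \<open>t\<close>, or one end is \<open>X - {t}\<close>.
  In the last case \<open>t\<close> is the larger of the two removed elements, so membership of
  \<open>X\<close> in \<open>I\<close> decides the direction.\<close>

lemma arc_insert_cases:
  assumes t: "\<forall>x\<in>V. x < t" and "finite V" and "arc (insert t V) (Suc k) I Y Z"
  shows "t \<notin> Y \<and> t \<notin> Z \<and> arc V (Suc k) I Y Z
    \<or> t \<in> Y \<and> t \<in> Z \<and> arc V k {X. insert t X \<in> I} (Y - {t}) (Z - {t})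
    \<or> t \<notin> Y \<and> t \<in> Z \<and> insert t Y \<notin> I
    \<or> t \<in> Y \<and> t \<notin> Z \<and> insert t Z \<in> I"
proof -
  have tV: "t \<notin> V" using t by blast
  have nlt: "\<not> t < x" if "x \<in> insert t V" for x
    using t that less_asym by blast
  obtain X a b where X: "X \<in> nsets (insert t V) (Suc (Suc k))" and ab: "a \<in> X" "b \<in> X" "a < b" and
    YZ: "X \<in> I \<and> Y = X - {a} \<and> Z = X - {b} \<or> X \<notin> I \<and> Y = X - {b} \<and> Z = X - {a}"
    using assms(3) by (elim arcE) blast+
  from X show ?thesis
  proof (cases rule: nsets_insertE)
    case 1
    then show ?thesis using ab YZ arcI1 arcI2 by (metis Diff_iff)
  next
    case (2 X' k')
    have at: "a \<noteq> t" using ab(2,3) X nlt[of b] by (auto simp: nsets_def)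
    show ?thesis
    proof (cases "b = t")
      case True
      then show ?thesis using YZ 2 at ab by auto
    next
      case False
      have "a \<in> X'" "b \<in> X'" "X' \<in> nsets V (Suc k)" using 2 ab at False by auto
      then have "arc V k {X. insert t X \<in> I} (Y - {t}) (Z - {t})"
        using YZ arcI1[of X' V k a b "{X. insert t X \<in> I}"] arcI2[of X' V k a b "{X. insert t X \<in> I}"]
          ab 2 at False by (auto simp: insert_Diff_if)
      then show ?thesis using YZ 2 at False by auto
    qed
  qed
qed

text \<open>The key to acyclicity: arcs between sets avoiding the largest element \<open>t\<close> never leave \<open>K\<close>.\<close>

lemma link_closed:
  assumes t: "\<forall>x\<in>V. x < t" and fin: "finite V" and con: "consistent (insert t V) (Suc k) I"
    and arc: "arc V k I Y Z" and Y: "insert t Y \<in> I"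
  shows "insert t Z \<in> I"
proof -
  have W: "insert t X \<in> nsets (insert t V) (Suc (Suc k))" "insert t X - {t} = X"
    "\<And>x. x \<in> X \<Longrightarrow> insert t X - {x} = insert t (X - {x})" "\<And>x. x \<in> X \<Longrightarrow> x < t"
    if "X \<in> nsets V (Suc k)" for X
  proof -
    have "t \<notin> X" "\<And>x. x \<in> X \<Longrightarrow> x < t" using that t by (auto simp: nsets_def)
    then show "insert t X - {t} = X" "\<And>x. x \<in> X \<Longrightarrow> insert t X - {x} = insert t (X - {x})" "\<And>x. x \<in> X \<Longrightarrow> x < t"
      by (auto simp: insert_Diff_if)
    show "insert t X \<in> nsets (insert t V) (Suc (Suc k))" using that fin t by (intro nsets_insert) auto
  qed
  \<comment> \<open>In the packet of \<open>insert t X\<close> the position of \<open>t\<close>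
    records whether \<open>X\<close> is in \<open>I\<close>, hence the direction of the arc. An arc
    leaving \<open>K\<close> would be an alternation at \<open>a\<close>, \<open>b\<close>,
    \<open>t\<close>.\<close>
  from arc show ?thesis
  proof (cases rule: arcE)
    case (1 X a b)
    then show ?thesis
      using consistentD[OF con W(1)[OF 1(1)], of a b t] W(2-4)[OF 1(1)] Y by (metis insertCI)
  next
    case (2 X a b)
    then show ?thesis
      using consistentD[OF con W(1)[OF 2(1)], of a b t] W(2-4)[OF 2(1)] Y by (metis insertCI)
  qed
qed

text \<open>An alternation of the link in the packet of \<open>W\<close> is an alternation of
  \<open>I\<close> in the packet of \<open>insert t W\<close>.\<close>

lemma consistent_link:
  assumes t: "\<forall>x\<in>V. x < t" and fin: "finite V" and con: "consistent (insert t V) (Suc k) I"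
  shows "consistent V k {X. insert t X \<in> I}"
  unfolding consistent_def
proof (intro ballI impI)
  fix W a b c
  assume W: "W \<in> nsets V (Suc k)" "a \<in> W" "b \<in> W" "c \<in> W" "a < b" "b < c"
    and e: "(W - {a} \<in> {X. insert t X \<in> I}) = (W - {c} \<in> {X. insert t X \<in> I})"
  have tW: "t \<notin> W" using t W by (auto simp: nsets_def)
  have "insert t W \<in> nsets (insert t V) (Suc (Suc k))"
    using t fin W(1) by (intro nsets_insert) auto
  moreover have "insert t W - {x} = insert t (W - {x})" if "x \<in> W" for x
    using that tW by auto
  ultimately show "(W - {b} \<in> {X. insert t X \<in> I}) = (W - {a} \<in> {X. insert t X \<in> I})"
    using consistentD[OF con, of "insert t W" a b c] W(2-6) e by (metis insertCI mem_Collect_eq)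
qed

lemma arc_0: "\<not> arc V 0 I Y Z"
  by (auto elim!: arcE simp: nsets_def card_Suc_eq)

text \<open>Acyclicity is stated through a natural-valued rank, so that it also serves to choose
  first elements and to sort lists by key.\<close>

lemma arc_rank:
  assumes "finite V" "consistent V (Suc k) I"
  shows "\<exists>\<rho> :: 'a set \<Rightarrow> nat. \<forall>Y Z. arc V k I Y Z \<longrightarrow> \<rho> Y < \<rho> Z"
  using assms
proof (induction V arbitrary: k I rule: finite_linorder_max_induct)
  case empty
  then show ?case by (simp add: arc_def nsets_empty_iff)
next
  case (insert t V)
  show ?case
  proof (cases k)
    case 0
    then show ?thesis by (simp add: arc_0)
  next
    case (Suc k')
    let ?K = "{X. insert t X \<in> I}"
    obtain \<rho>1 :: "'a set \<Rightarrow> nat" where r1: "\<And>Y Z. arc V k I Y Z \<Longrightarrow> \<rho>1 Y < \<rho>1 Z"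
      using insert.IH[OF consistent_mono[OF insert.prems subset_insertI]] by blast
    obtain \<rho>2 :: "'a set \<Rightarrow> nat" where r2: "\<And>Y Z. arc V k' ?K Y Z \<Longrightarrow> \<rho>2 Y < \<rho>2 Z"
      using insert.IH[OF consistent_link[OF insert.hyps(2,1) insert.prems[unfolded Suc]]] by blast
    \<comment> \<open>These bound \<open>\<rho>1\<close> and \<open>\<rho>2\<close> strictly on
      subsets of \<open>V\<close>. In \<open>\<rho>\<close> the three parts therefore occupy
      consecutive ranges: below \<open>M1\<close>, then from \<open>M1\<close>, then from
      \<open>M1 + M2\<close>.\<close>
    define M1 where "M1 = Suc (\<Sum>Y\<in>Pow V. \<rho>1 Y)"
    define M2 where "M2 = Suc (\<Sum>Y\<in>Pow V. \<rho>2 Y)"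
    have M1: "\<rho>1 Y < M1" if "Y \<subseteq> V" for Y
      using that insert.hyps(1) member_le_sum[of Y "Pow V" \<rho>1] by (simp add: M1_def less_Suc_eq_le)
    have M2: "\<rho>2 Y < M2" if "Y \<subseteq> V" for Y
      using that insert.hyps(1) member_le_sum[of Y "Pow V" \<rho>2] by (simp add: M2_def less_Suc_eq_le)
    define \<rho> where "\<rho> Y = (if t \<in> Y then M1 + \<rho>2 (Y - {t}) else if insert t Y \<in> I then M1 + M2 + \<rho>1 Y else \<rho>1 Y)" for Y
    have "\<rho> Y < \<rho> Z" if arc: "arc (insert t V) k I Y Z" for Y Z
    proof -
      have sub: "Y \<subseteq> insert t V" "Z \<subseteq> insert t V"
        using arc_nsets[OF arc] by (auto simp: nsets_def)
      then have "\<rho>2 (Y - {t}) < M2" "t \<notin> Y \<Longrightarrow> \<rho>1 Y < M1"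
        by (auto intro!: M1 M2)
      then show ?thesis
        using arc_insert_cases[OF insert.hyps(2,1) arc[unfolded Suc]] r1[of Y Z] r2[of "Y - {t}" "Z - {t}"]
          link_closed[OF insert.hyps(2,1) insert.prems, of Y Z]
        unfolding \<rho>_def Suc[symmetric] by (elim disjE conjE) auto
    qed
    then show ?thesis by blast
  qed
qed

section \<open>Reversal of the ground order\<close>

lemma consistent_dual: "linorder.consistent (\<lambda>x y. y < x) V k I \<longleftrightarrow> consistent V k I"
  unfolding linorder.consistent_def[OF dual_linorder] consistent_def by blast

text \<open>Reversal exchanges the roles of \<open>a\<close> and \<open>b\<close> and so turns every
  packet around; complementing \<open>I\<close> turns it back.\<close>

lemma arc_dual: "linorder.arc (\<lambda>x y. y < x) V k I Y Z \<longleftrightarrow> arc V k (- I) Y Z"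
  unfolding linorder.arc_def[OF dual_linorder] arc_def by auto

lemma closed_dual: "linorder.closed (\<lambda>x y. y < x) V k I J \<longleftrightarrow> closed V k (- I) J"
  unfolding linorder.closed_def[OF dual_linorder] closed_def arc_dual ..

section \<open>The two extremal inversion sets\<close>

text \<open>The position \<open>X - {Max X}\<close> tells from which side \<open>J\<close> fills the
  packet of \<open>X\<close>, and orienting each packet accordingly makes \<open>J\<close> initial.
  A full packet is oriented lexicographically, a packet missed by \<open>J\<close>
  antilexicographically.\<close>

lemma exists_inversion_set:
  assumes con: "consistent V k J"
  shows "\<exists>I. consistent V (Suc k) I \<and> closed V k I J \<and>
    (\<forall>X\<in>nsets V (Suc k). ((\<forall>a\<in>X. X - {a} \<in> J) \<longrightarrow> X \<notin> I) \<and> ((\<forall>a\<in>X. X - {a} \<notin> J) \<longrightarrow> X \<in> I))"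
proof (intro exI conjI)
  define I where "I = {X. X - {Max X} \<notin> J}"
  have fin: "finite X" "X \<noteq> {}" if "X \<in> nsets V (Suc m)" for X m
    using that by (auto simp: nsets_def)
  show "consistent V (Suc k) I"
    unfolding consistent_def
  proof (intro ballI impI)
    fix W a b c
    assume W: "W \<in> nsets V (Suc (Suc k))" "a \<in> W" "b \<in> W" "c \<in> W" and lt: "a < b" "b < c"
      and e: "(W - {a} \<in> I) = (W - {c} \<in> I)"
    define t where "t = Max W"
    have t: "t \<in> W" "\<And>x. x \<in> W \<Longrightarrow> x \<le> t"
      using fin[OF W(1)] by (auto simp: t_def)
    have Wt: "W - {t} \<in> nsets V (Suc k)" using W(1) t(1) by (rule nsets_remove)
    have inI: "W - {x} \<in> I \<longleftrightarrow> W - {t} - {x} \<notin> J" if "x \<in> W" "x \<noteq> t" for x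
    proof -
      have "Max (W - {x}) = t" using fin[OF W(1)] t that by (intro Max_eqI) auto
      then show ?thesis by (simp add: I_def insert_commute Diff_insert2[symmetric] Diff_insert[symmetric])
    qed
    have ab: "a \<noteq> t" "b \<noteq> t" using lt t(2) W by (auto simp: not_le[symmetric])
    show "(W - {b} \<in> I) = (W - {a} \<in> I)"
    proof (cases "c = t")
      case False
      then show ?thesis
        using consistentD[OF con Wt, of a b c] W lt e inI ab by auto
    next
      case True
      \<comment> \<open>Positions \<open>t\<close> and \<open>s\<close> carry the same value, both
        being decided by \<open>W - {t} - {s}\<close>. So \<open>c = t\<close> may be replaced by
        \<open>s\<close>.\<close>
      define s where "s = Max (W - {t})"
      have s: "s \<in> W - {t}" "\<And>x. x \<in> W - {t} \<Longrightarrow> x \<le> s"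
        using fin[OF Wt] Max_in[of "W - {t}"] by (auto simp: s_def)
      have "b = s \<or> b < s" using s(2)[of b] W ab by (auto simp: le_less)
      moreover have "W - {t} \<in> I \<longleftrightarrow> W - {t} - {s} \<notin> J" by (simp add: I_def s_def)
      ultimately show ?thesis
        using consistentD[OF con Wt, of a b s] W lt e inI ab s True by (cases "b = s") auto
    qed
  qed
  show "closed V k I J"
    unfolding closed_def
  proof (intro allI impI)
    fix Y Z assume arc: "arc V k I Y Z" and Z: "Z \<in> J"
    have M: "Max X \<in> X" "\<And>x. x \<in> X \<Longrightarrow> x \<noteq> Max X \<Longrightarrow> x < Max X" if "X \<in> nsets V (Suc k)" for X
      using fin[OF that] by (auto simp: less_le)
    from arc show "Y \<in> J"
    proof (cases rule: arcE)
      case (1 X a b)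
      then show ?thesis
        using consistentD[OF con 1(1), of a b "Max X"] M[OF 1(1)] Z unfolding I_def by blast
    next
      case (2 X a b)
      then show ?thesis
        using consistentD[OF con 2(1), of a b "Max X"] M[OF 2(1)] Z unfolding I_def by blast
    qed
  qed
  show "\<forall>X\<in>nsets V (Suc k). ((\<forall>a\<in>X. X - {a} \<in> J) \<longrightarrow> X \<notin> I) \<and> ((\<forall>a\<in>X. X - {a} \<notin> J) \<longrightarrow> X \<in> I)"
    using fin by (auto simp: I_def)
qed

text \<open>Reversal and complement turn the previous witness into
  \<open>{X. X - {Min X} \<in> J}\<close>; full and missed packets exchange their
  orientations.\<close>

lemma exists_inversion_set':
  assumes "consistent V k J"
  shows "\<exists>I. consistent V (Suc k) I \<and> closed V k I J \<and>
    (\<forall>X\<in>nsets V (Suc k). ((\<forall>a\<in>X. X - {a} \<in> J) \<longrightarrow> X \<in> I) \<and> ((\<forall>a\<in>X. X - {a} \<notin> J) \<longrightarrow> X \<notin> I))"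
proof -
  obtain I where "consistent V (Suc k) I" "closed V k (- I) J"
    "\<forall>X\<in>nsets V (Suc k). ((\<forall>a\<in>X. X - {a} \<in> J) \<longrightarrow> X \<notin> I) \<and> ((\<forall>a\<in>X. X - {a} \<notin> J) \<longrightarrow> X \<in> I)"
    using linorder.exists_inversion_set[OF dual_linorder, unfolded consistent_dual closed_dual, OF assms] by blast
  then show ?thesis by (intro exI[of _ "- I"]) (simp add: consistent_Compl)
qed

section \<open>Removing or adding one full packet\<close>

text \<open>In \<open>flip_down\<close>, \<open>P\<close> is the trace of the inversion set on one packet, \<open>y\<close> marks the element to be
  removed and \<open>ext\<close> says that it is the extremal one among those marked by \<open>P\<close> other than \<open>t\<close>.\<close>

lemma alternation_remove:
  assumes P: "\<And>a b c. a \<in> W \<Longrightarrow> b \<in> W \<Longrightarrow> c \<in> W \<Longrightarrow> a < b \<Longrightarrow> b < c \<Longrightarrow> (P a \<longleftrightarrow> P c) \<Longrightarrow> (P b \<longleftrightarrow> P a)"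
    and t: "t \<in> W" "\<And>x. x \<in> W \<Longrightarrow> x \<le> t"
    and y: "y \<in> W" "y \<noteq> t" "P y"
    and ext: "\<And>x. x \<in> W \<Longrightarrow> x \<noteq> t \<Longrightarrow> x \<noteq> y \<Longrightarrow> P x \<Longrightarrow> (if P t then y < x else x < y)"
    and abc: "a \<in> W" "b \<in> W" "c \<in> W" "a < b" "b < c"
    and e: "(P a \<and> a \<noteq> y) = (P c \<and> c \<noteq> y)"
  shows "(P b \<and> b \<noteq> y) = (P a \<and> a \<noteq> y)"
proof -
  have ct: "c = t \<or> c < t" using t(2)[OF abc(3)] by (auto simp: le_less)
  have nt: "a \<noteq> t" "b \<noteq> t" using abc t(2) by (auto simp: not_le[symmetric])
  have asym: "\<not> b < a" "\<not> c < b" "\<not> c < a" "a \<noteq> b" "b \<noteq> a" "b \<noteq> c" "c \<noteq> b" "a \<noteq> c" "c \<noteq> a" "a < c"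
    using abc by auto
  \<comment> \<open>Only triples through \<open>y\<close> change. The value at \<open>t\<close>
    decides on which side of \<open>y\<close> the other marked positions lie, and comparison with
    \<open>t\<close> excludes an alternation in each case.\<close>
  consider "y \<notin> {a,b,c}" | "y = a" | "y = b" | "y = c" by blast
  then show ?thesis
  proof cases
    case 1
    then have "a \<noteq> y" "b \<noteq> y" "c \<noteq> y" by blast+
    then show ?thesis using P[OF abc] e by blast
  next
    case 2
    have "P c" if "P b"
    proof -
      have "P t" using ext[of b] 2 abc(2) nt asym that by (simp split: if_splits)
      then show ?thesis using P[OF abc(1,3) t(1) asym(10)] ct 2 y(3) by blast
    qed
    then show ?thesis using 2 e asym by blast
  next
    case 3
    have "\<not> (P a \<and> P c)"
    proof
      assume ac: "P a \<and> P c"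
      then have "\<not> P t" using ext[of a] 3 abc(1) nt asym by (simp split: if_splits)
      then show False using ext[of c] 3 abc(3) ac asym ct by (auto split: if_splits)
    qed
    then show ?thesis using e 3 asym by blast
  next
    case 4
    have "P a" if "P b"
    proof -
      have "\<not> P t" using ext[of b] 4 abc(2) nt asym that by (simp split: if_splits)
      then show ?thesis using P[OF abc(1,3) t(1) asym(10)] 4 y(2,3) ct by blast
    qed
    then show ?thesis using 4 e asym P[OF abc] y(3) by blast
  qed
qed

text \<open>Induction on the largest element \<open>t\<close>. If some \<open>Y\<close> in
  \<open>J\<close> avoids \<open>t\<close> and has \<open>insert t Y\<close> in \<open>I\<close>,
  the first such \<open>Y\<close> in the arc order yields \<open>X = insert t Y\<close>. Otherwise
  the \<open>X\<close> found on the smaller ground set remains removable.\<close>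

lemma flip_down:
  assumes "finite V" "consistent V (Suc k) I" "closed V k I J"
    and "X0 \<in> nsets V (Suc k)" "X0 \<in> I" "\<forall>a\<in>X0. X0 - {a} \<in> J"
  shows "\<exists>X\<in>nsets V (Suc k). X \<in> I \<and> (\<forall>a\<in>X. X - {a} \<in> J) \<and> consistent V (Suc k) (I - {X})"
  using assms
proof (induction V arbitrary: k I J X0 rule: finite_linorder_max_induct)
  case empty
  then show ?case by (simp add: nsets_empty_iff)
next
  case (insert t V)
  note t = insert.hyps(2)
  note con = insert.prems(1)
  have tV: "t \<notin> V" using t by blast
  have split: "W - {t} \<in> nsets V m" if "W \<in> nsets (insert t V) (Suc m)" "t \<in> W" for W m
    using nsets_remove[OF that] by (auto simp: nsets_def)
  show ?case
  proof (cases "\<exists>Y\<in>nsets V k. insert t Y \<in> I \<and> Y \<in> J")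
    case True
    \<comment> \<open>A first element \<open>Y\<close> of \<open>K \<inter> J\<close> is also first in \<open>K\<close>, because \<open>J\<close> is closed under predecessors.\<close>
    obtain \<rho> :: "'a set \<Rightarrow> nat" where r: "\<And>Y Z. arc V k I Y Z \<Longrightarrow> \<rho> Y < \<rho> Z"
      using arc_rank[OF insert.hyps(1) consistent_mono[OF con subset_insertI]] by blast
    obtain Y where Y: "Y \<in> nsets V k" "insert t Y \<in> I" "Y \<in> J"
      and min: "\<And>Z. Z \<in> nsets V k \<Longrightarrow> insert t Z \<in> I \<Longrightarrow> Z \<in> J \<Longrightarrow> \<rho> Y \<le> \<rho> Z"
      using True ex_has_least_nat[of "\<lambda>Y. Y \<in> nsets V k \<and> insert t Y \<in> I \<and> Y \<in> J" _ \<rho>] by blast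
    define X where "X = insert t Y"
    have tY: "t \<notin> Y" using Y(1) tV by (auto simp: nsets_def)
    have X: "X \<in> nsets (insert t V) (Suc k)"
      unfolding X_def using Y(1) insert.hyps(1) tV by (rule nsets_insert)
    have Xt: "X - {t} = Y" using tY by (simp add: X_def)
    have first: "\<not> arc V k I Z Y" if "insert t Z \<in> I" for Z
    proof
      assume arc: "arc V k I Z Y"
      have "Z \<in> nsets V k" using arc_nsets[OF arc] by blast
      moreover have "Z \<in> J"
        using insert.prems(2) arc_mono[OF arc subset_insertI] Y(3) unfolding closed_def by blast
      ultimately show False using min[OF _ that] r[OF arc] by simp
    qed
    have "X - {a} \<in> J" if "a \<in> X" for a
    proof (cases "a = t")
      case False
      then have "a < t" using that t Y(1) by (auto simp: X_def nsets_def)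
      then have "arc (insert t V) k I (X - {a}) (X - {t})"
        using that Y(2) by (intro arcI1[OF X]) (simp_all add: X_def)
      then show ?thesis using insert.prems(2) Y(3) unfolding closed_def Xt by blast
    qed (simp add: Xt Y)
    moreover have "consistent (insert t V) (Suc k) (I - {X})"
      unfolding consistent_def
    proof (intro ballI impI)
      fix W a b c
      assume W: "W \<in> nsets (insert t V) (Suc (Suc k))" "a \<in> W" "b \<in> W" "c \<in> W" "a < b" "b < c"
        and e: "(W - {a} \<in> I - {X}) = (W - {c} \<in> I - {X})"
      show "(W - {b} \<in> I - {X}) = (W - {a} \<in> I - {X})"
      proof (cases "\<exists>y\<in>W. W - {y} = X")
        case False
        then show ?thesis using consistentD[OF con W] W e by auto
      next
        case True
        then obtain y where y: "y \<in> W" "W - {y} = X" by blast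
        then have tW: "t \<in> W" "y \<noteq> t" by (auto simp: X_def)
        let ?W = "W - {t}"
        have W': "?W \<in> nsets V (Suc k)" using W(1) tW(1) by (rule split)
        have Yy: "Y = ?W - {y}" using y Xt by blast
        have lt: "x \<le> t" if "x \<in> W" for x using that W(1) t by (auto simp: nsets_def le_less)
        \<comment> \<open>The set \<open>?W - {x}\<close> lies in \<open>K\<close>, so it does not
          precede \<open>Y = ?W - {y}\<close>. The orientation of the packet of \<open>?W\<close>,
          that is, whether \<open>W - {t}\<close> is in \<open>I\<close>, turns this into a
          comparison of \<open>x\<close> with \<open>y\<close>.\<close>
        have ext: "if W - {t} \<in> I then y < x else x < y" if x: "x \<in> W" "x \<noteq> t" "x \<noteq> y" "W - {x} \<in> I" for x
        proof -
          have "insert t (?W - {x}) = W - {x}" using tW x by auto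
          then have "\<not> arc V k I (?W - {x}) (?W - {y})" using first[of "?W - {x}"] x Yy by simp
          then show ?thesis
            using arcI1[OF W', of x y I] arcI2[OF W', of y x I] x y tW by (auto simp: not_less_iff_gr_or_eq)
        qed
        have eq: "W - {x} \<in> I - {X} \<longleftrightarrow> W - {x} \<in> I \<and> x \<noteq> y" if "x \<in> W" for x
          using that y by auto
        have inI: "W - {y} \<in> I" using y Y(2) by (simp add: X_def)
        show ?thesis
          unfolding eq[OF W(2)] eq[OF W(3)] eq[OF W(4)]
        proof (rule alternation_remove[of W "\<lambda>x. W - {x} \<in> I" t y a b c])
          show "(W - {b'} \<in> I) = (W - {a'} \<in> I)"
            if "a' \<in> W" "b' \<in> W" "c' \<in> W" "a' < b'" "b' < c'" "(W - {a'} \<in> I) = (W - {c'} \<in> I)" for a' b' c'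
            by (rule consistentD[OF con W(1) that])
          show "if W - {t} \<in> I then y < x else x < y" if "x \<in> W" "x \<noteq> t" "x \<noteq> y" "W - {x} \<in> I" for x
            using that by (rule ext)
          show "(W - {a} \<in> I \<and> a \<noteq> y) = (W - {c} \<in> I \<and> c \<noteq> y)"
            using e unfolding eq[OF W(2)] eq[OF W(4)] .
        qed (use tW lt y inI W(2-6) in simp_all)
      qed
    qed
    ultimately show ?thesis using X Y(2) unfolding X_def by blast
  next
    case False
    have "t \<notin> X0"
    proof
      assume "t \<in> X0"
      then have "X0 - {t} \<in> nsets V k" "insert t (X0 - {t}) = X0" "X0 - {t} \<in> J"
        using split[OF insert.prems(3)] insert.prems(5) by blast+
      then show False using False insert.prems(4) by metis
    qed
    then have X0: "X0 \<in> nsets V (Suc k)" using insert.prems(3) by (auto simp: nsets_def)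
    have clo: "closed V k I J"
      using insert.prems(2) arc_mono[OF _ subset_insertI] unfolding closed_def by blast
    obtain X where X: "X \<in> nsets V (Suc k)" "X \<in> I" "\<forall>a\<in>X. X - {a} \<in> J" "consistent V (Suc k) (I - {X})"
      using insert.IH[OF consistent_mono[OF con subset_insertI] clo X0 insert.prems(4,5)] by blast
    have "consistent (insert t V) (Suc k) (I - {X})"
      unfolding consistent_def
    proof (intro ballI impI)
      fix W a b c
      assume W: "W \<in> nsets (insert t V) (Suc (Suc k))" "a \<in> W" "b \<in> W" "c \<in> W" "a < b" "b < c"
        and e: "(W - {a} \<in> I - {X}) = (W - {c} \<in> I - {X})"
      show "(W - {b} \<in> I - {X}) = (W - {a} \<in> I - {X})"
      proof (cases "t \<in> W")
        case False
        then have W': "W \<in> nsets V (Suc (Suc k))" using W(1) by (auto simp: nsets_def)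
        show ?thesis by (rule consistentD[OF X(4) W' W(2-6) e])
      next
        case True
        have lt: "x \<le> t" if "x \<in> W" for x using that W(1) t by (auto simp: nsets_def le_less)
        have neq: "W - {x} \<noteq> X" if "x \<in> W" "x \<noteq> t" for x
          using that True X(1) tV by (auto simp: nsets_def)
        have ab: "a \<noteq> t" "b \<noteq> t" using W(2-6) lt by (auto simp: not_le[symmetric])
        show ?thesis
        proof (cases "c = t \<and> W - {t} = X")
          case ct: False
          have "W - {a} \<noteq> X" "W - {b} \<noteq> X" "W - {c} \<noteq> X"
            using neq ab W(2-4) ct by blast+
          then have eqs: "(W - {a} \<in> I - {X}) = (W - {a} \<in> I)" "(W - {b} \<in> I - {X}) = (W - {b} \<in> I)"
            "(W - {c} \<in> I - {X}) = (W - {c} \<in> I)" by simp_all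
          show ?thesis using consistentD[OF con W] e unfolding eqs .
        next
          case c: True
          \<comment> \<open>Here the removal affects only position \<open>t\<close>. The others were
            already outside \<open>I\<close>: otherwise \<open>X - {x}\<close> would be a member of
            \<open>J\<close> with \<open>insert t (X - {x})\<close> in \<open>I\<close>, against the
            case assumption.\<close>
          have "W - {x} \<notin> I" if "x \<in> W" "x \<noteq> t" for x
          proof -
            have xX: "x \<in> X" using that c by blast
            have "insert t (W - {t} - {x}) = W - {x}" using that True by blast
            moreover have "X - {x} \<in> nsets V k" "X - {x} \<in> J"
              using nsets_remove[OF X(1) xX] X(3) xX by blast+
            ultimately show ?thesis using False c by metis
          qed
          then show ?thesis using ab W(2,3) by blast
        qed
      qed
    qed
    moreover have "X \<in> nsets (insert t V) (Suc k)" using X(1) by (auto simp: nsets_def)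
    ultimately show ?thesis using X(2,3) by blast
  qed
qed

lemma flip_up:
  assumes "finite V" "consistent V (Suc k) I" "closed V k I J"
    and "X0 \<in> nsets V (Suc k)" "X0 \<notin> I" "\<forall>a\<in>X0. X0 - {a} \<in> J"
  shows "\<exists>X\<in>nsets V (Suc k). X \<notin> I \<and> (\<forall>a\<in>X. X - {a} \<in> J) \<and> consistent V (Suc k) (insert X I)"
proof -
  have eq: "- I - {X} = - insert X I" for X by blast
  have "\<exists>X\<in>nsets V (Suc k). X \<in> - I \<and> (\<forall>a\<in>X. X - {a} \<in> J) \<and> consistent V (Suc k) (- I - {X})"
    using linorder.flip_down[OF dual_linorder, unfolded consistent_dual closed_dual, of V k "- I" J X0] assms
    by (simp add: consistent_Compl)
  then show ?thesis unfolding eq consistent_Compl by blast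
qed

end

section \<open>Linear extensions and adjacent swaps\<close>

definition linear_extension :: "('a \<Rightarrow> 'a \<Rightarrow> bool) \<Rightarrow> 'a set \<Rightarrow> 'a list \<Rightarrow> bool" where
  "linear_extension R A xs \<longleftrightarrow> distinct xs \<and> set xs = A \<and> sorted_wrt (\<lambda>y z. \<not> R z y) xs"

lemma linear_extension_exists:
  fixes \<rho> :: "'a \<Rightarrow> nat"
  assumes "finite A" and "\<And>y z. R y z \<Longrightarrow> \<rho> y < \<rho> z"
  shows "\<exists>xs. linear_extension R A xs"
proof -
  obtain xs where xs: "set xs = A" "distinct xs" using finite_distinct_list[OF assms(1)] by blast
  have "sorted_wrt (\<lambda>y z. \<rho> y \<le> \<rho> z) (sort_key \<rho> xs)"
    using sorted_sort_key[of \<rho> xs] by (simp add: sorted_map)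
  then have "sorted_wrt (\<lambda>y z. \<not> R z y) (sort_key \<rho> xs)"
    by (rule sorted_wrt_mono_rel[rotated]) (use assms(2) in fastforce)
  then have "linear_extension R A (sort_key \<rho> xs)" using xs by (simp add: linear_extension_def)
  then show ?thesis by blast
qed

definition swap_step :: "('a \<Rightarrow> 'a \<Rightarrow> bool) \<Rightarrow> 'a list \<Rightarrow> 'a list \<Rightarrow> bool" where
  "swap_step R xs ys \<longleftrightarrow> (\<exists>us y z vs. xs = us @ [y, z] @ vs \<and> ys = us @ [z, y] @ vs \<and> \<not> R y z \<and> \<not> R z y)"

lemma swap_step_Cons: "swap_step R xs ys \<Longrightarrow> swap_step R (x # xs) (x # ys)"
  unfolding swap_step_def by (metis append_Cons)

lemma swap_steps_Cons: "(swap_step R)\<^sup>*\<^sup>* xs ys \<Longrightarrow> (swap_step R)\<^sup>*\<^sup>* (x # xs) (x # ys)"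
  by (induction rule: rtranclp_induct) (auto intro: rtranclp.rtrancl_into_rtrancl swap_step_Cons)

lemma swap_steps_move:
  assumes "\<And>u. u \<in> set us \<Longrightarrow> \<not> R u x \<and> \<not> R x u"
  shows "(swap_step R)\<^sup>*\<^sup>* (x # us @ vs) (us @ x # vs)"
  using assms
proof (induction us)
  case (Cons u us)
  have "swap_step R (x # u # us @ vs) (u # x # us @ vs)"
    unfolding swap_step_def using Cons.prems[of u] by (metis append_Cons append_Nil list.set_intros(1))
  moreover have "(swap_step R)\<^sup>*\<^sup>* (u # x # us @ vs) (u # us @ x # vs)"
    using Cons by (intro swap_steps_Cons) auto
  ultimately show ?case by (simp add: converse_rtranclp_into_rtranclp)
qed simp

text \<open>The head \<open>x\<close> of \<open>xs\<close> can be moved to the front of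
  \<open>ys\<close>: an element \<open>u\<close> before it in \<open>ys\<close> comes after it in
  \<open>xs\<close>, so neither relation between \<open>u\<close> and \<open>x\<close> is possible.
  The tails are handled by induction.\<close>

lemma linear_extensions_connected:
  assumes "linear_extension R A xs" "linear_extension R A ys"
  shows "(swap_step R)\<^sup>*\<^sup>* xs ys"
  using assms
proof (induction xs arbitrary: A ys)
  case Nil
  then show ?case by (simp add: linear_extension_def)
next
  case (Cons x xs)
  then have "x \<in> set ys" by (auto simp: linear_extension_def)
  then obtain us vs where ys: "ys = us @ x # vs" by (meson split_list)
  have set: "set xs = set (us @ vs)" using Cons.prems unfolding ys linear_extension_def by auto
  have "linear_extension R (set xs) xs" "linear_extension R (set xs) (us @ vs)"
    using Cons.prems set unfolding ys linear_extension_def by (auto simp: sorted_wrt_append)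
  then have "(swap_step R)\<^sup>*\<^sup>* (x # xs) (x # us @ vs)" by (intro swap_steps_Cons Cons.IH)
  moreover have "\<not> R u x \<and> \<not> R x u" if "u \<in> set us" for u
    using that Cons.prems set unfolding ys linear_extension_def by (auto simp: sorted_wrt_append)
  then have "(swap_step R)\<^sup>*\<^sup>* (x # us @ vs) ys" unfolding ys by (rule swap_steps_move)
  ultimately show ?case by simp
qed

lemma swap_step_linear_extension:
  assumes "swap_step R xs ys" "linear_extension R A xs"
  shows "linear_extension R A ys"
  using assms unfolding swap_step_def linear_extension_def by (force simp: sorted_wrt_append)

section \<open>Making a packet contiguous\<close>

text \<open>Outside \<open>P\<close> the two relations share the arcs \<open>Q\<close>. A chain of
  such arcs from \<open>P\<close> to \<open>P\<close> would close a cycle with \<open>R\<close> or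
  with \<open>R'\<close>, since these order \<open>P\<close> totally and oppositely; the ranks
  forbid both. Hence \<open>P\<close> fits into one block, and reversing the block passes from
  \<open>R\<close> to \<open>R'\<close>.\<close>

lemma contiguous_block:
  fixes \<rho> \<rho>' :: "'a \<Rightarrow> nat"
  assumes fin: "finite A" and PA: "P \<subseteq> A"
    and r: "\<And>y z. R y z \<Longrightarrow> \<rho> y < \<rho> z" and r': "\<And>y z. R' y z \<Longrightarrow> \<rho>' y < \<rho>' z"
    and out: "\<And>y z. \<not> (y \<in> P \<and> z \<in> P) \<Longrightarrow> R y z \<longleftrightarrow> R' y z"
    and rev: "\<And>y z. y \<in> P \<Longrightarrow> z \<in> P \<Longrightarrow> R y z \<longleftrightarrow> R' z y"
    and tot: "\<And>y z. y \<in> P \<Longrightarrow> z \<in> P \<Longrightarrow> y \<noteq> z \<Longrightarrow> R y z \<or> R z y"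
  shows "\<exists>xs bs ys. linear_extension R A (xs @ bs @ ys) \<and> set bs = P \<and> linear_extension R' A (xs @ rev bs @ ys)"
proof -
  define Q where "Q y z \<longleftrightarrow> R y z \<and> \<not> (y \<in> P \<and> z \<in> P)" for y z
  have Qr: "\<rho> y < \<rho> z \<and> \<rho>' y < \<rho>' z" if "Q\<^sup>+\<^sup>+ y z" for y z
    using that
  proof (induction rule: tranclp_induct)
    case (base z)
    then show ?case using r r' out by (auto simp: Q_def)
  next
    case (step z w)
    then have "\<rho> z < \<rho> w" "\<rho>' z < \<rho>' w" using r r' out by (auto simp: Q_def)
    then show ?case using step.IH by simp
  qed
  have PP: "\<not> Q\<^sup>+\<^sup>+ y z" if yz: "y \<in> P" "z \<in> P" for y z
  proof
    assume "Q\<^sup>+\<^sup>+ y z"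
    then have lt: "\<rho> y < \<rho> z" "\<rho>' y < \<rho>' z" using Qr by blast+
    then have "y \<noteq> z" by auto
    then have "R z y \<or> R' z y" using tot[OF yz] rev[OF yz] by blast
    then show False using r[of z y] r'[of z y] lt by auto
  qed
  \<comment> \<open>By \<open>PP\<close>, no path leaves \<open>P\<close> and returns, so everything that must precede \<open>P\<close> can be placed first.\<close>
  define L where "L = {y \<in> A - P. \<exists>z\<in>P. Q\<^sup>+\<^sup>+ y z}"
  have downL: "y \<in> L" if yz: "R y z" "z \<in> L" "y \<in> A" for y z
  proof -
    obtain p where p: "p \<in> P" "Q\<^sup>+\<^sup>+ z p" using yz(2) by (auto simp: L_def)
    have "Q y z" using yz by (auto simp: Q_def L_def)
    then have "Q\<^sup>+\<^sup>+ y p" using p(2) by (rule tranclp_into_tranclp2)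
    then show ?thesis using PP[of y p] p(1) yz(3) by (auto simp: L_def)
  qed
  have downP: "y \<in> L \<union> P" if "R y z" "z \<in> P" "y \<in> A" for y z
  proof (cases "y \<in> P")
    case False
    then have "Q\<^sup>+\<^sup>+ y z" using that by (intro tranclp.r_into_trancl) (simp add: Q_def)
    then show ?thesis using that False by (auto simp: L_def)
  qed simp
  have "finite L" "finite P" "finite (A - L - P)" using fin PA by (auto simp: L_def finite_subset)
  then obtain xs bs ys where lists: "linear_extension R L xs" "linear_extension R P bs" "linear_extension R (A - L - P) ys"
    using linear_extension_exists[of _ R \<rho>, OF _ r] by metis
  have LP: "L \<inter> P = {}" "L \<subseteq> A" by (auto simp: L_def)
  have cross: "\<not> R z y" if "y \<in> L \<and> z \<in> A - L \<or> y \<in> L \<union> P \<and> z \<in> A - L - P" for y z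
    using that downL[of z y] downP[of z y] by blast
  have cross': "\<not> R' z y" if "y \<in> L \<and> z \<in> A - L \<or> y \<in> L \<union> P \<and> z \<in> A - L - P" for y z
    using cross[OF that] that out[of z y] LP by blast
  have crosses: "\<not> R z y \<and> \<not> R' z y" if "y \<in> L \<and> z \<in> P \<or> y \<in> L \<and> z \<in> A - L - P \<or> y \<in> P \<and> z \<in> A - L - P" for y z
    using that cross[of y z] cross'[of y z] LP PA by blast
  have le: "linear_extension R A (xs @ bs @ ys)"
    using lists LP PA crosses unfolding linear_extension_def by (auto simp: sorted_wrt_append)
  have "sorted_wrt (\<lambda>y z. \<not> R' z y) xs"
    using lists(1) LP out unfolding linear_extension_def by (auto elim!: sorted_wrt_mono_rel[rotated])
  moreover have "sorted_wrt (\<lambda>y z. \<not> R' z y) ys"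
    using lists(3) out unfolding linear_extension_def by (auto elim!: sorted_wrt_mono_rel[rotated])
  moreover have "sorted_wrt (\<lambda>y z. \<not> R' z y) (rev bs)"
    using lists(2) rev unfolding linear_extension_def sorted_wrt_rev by (auto elim!: sorted_wrt_mono_rel[rotated])
  ultimately have "linear_extension R' A (xs @ rev bs @ ys)"
    using lists LP PA crosses unfolding linear_extension_def by (auto simp: sorted_wrt_append)
  then show ?thesis using le lists(2) unfolding linear_extension_def by blast
qed

section \<open>Positions in lists\<close>

definition pos :: "'a list \<Rightarrow> 'a \<Rightarrow> nat" where
  "pos xs y = length (takeWhile (\<lambda>z. z \<noteq> y) xs)"

lemma pos_le: "pos xs y \<le> length xs"
  unfolding pos_def by (rule length_takeWhile_le)

lemma in_set_take_iff_pos: "i \<le> length xs \<Longrightarrow> y \<in> set (take i xs) \<longleftrightarrow> pos xs y < i"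
proof (induction xs arbitrary: i)
  case (Cons x xs)
  then show ?case by (cases i) (auto simp: pos_def)
qed (simp add: pos_def)

lemma in_set_iff_pos: "y \<in> set xs \<longleftrightarrow> pos xs y < length xs"
  using in_set_take_iff_pos[of "length xs" xs y] by simp

lemma pos_inject: "y \<in> set xs \<Longrightarrow> pos xs y = pos xs z \<longleftrightarrow> y = z"
  by (induction xs) (auto simp: pos_def)

lemma sorted_wrt_iff_pos:
  "distinct xs \<Longrightarrow> sorted_wrt P xs \<longleftrightarrow> (\<forall>y\<in>set xs. \<forall>z\<in>set xs. pos xs y < pos xs z \<longrightarrow> P y z)"
proof (induction xs)
  case (Cons x xs)
  then show ?case by (auto simp: pos_def)
qed simp

lemma sorted_wrt_filter_iff: "sorted_wrt P (filter Q xs) \<longleftrightarrow> sorted_wrt (\<lambda>y z. Q y \<longrightarrow> Q z \<longrightarrow> P y z) xs"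
  by (induction xs) auto

section \<open>Closed sets and the order of a packet along a path\<close>

context linorder
begin

text \<open>The arcs order each packet by the removed element, upwards or downwards. A closed set
  meets it in an initial segment of that order, which leaves no alternation.\<close>

lemma closed_consistent:
  assumes "closed V k I J"
  shows "consistent V k J"
  unfolding consistent_def
proof (intro ballI impI)
  fix X a b c
  assume X: "X \<in> nsets V (Suc k)" "a \<in> X" "b \<in> X" "c \<in> X" and lt: "a < b" "b < c"
    and e: "(X - {a} \<in> J) = (X - {c} \<in> J)"
  show "(X - {b} \<in> J) = (X - {a} \<in> J)"
  proof (cases "X \<in> I")
    case True
    then have "arc V k I (X - {a}) (X - {b})" "arc V k I (X - {b}) (X - {c})"
      using X lt by (simp_all add: arcI1)
    then show ?thesis using assms e unfolding closed_def by blast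
  next
    case False
    then have "arc V k I (X - {c}) (X - {b})" "arc V k I (X - {b}) (X - {a})"
      using X lt by (simp_all add: arcI2)
    then show ?thesis using assms e unfolding closed_def by blast
  qed
qed

text \<open>A prefix of a linear extension of a closed set is again closed.\<close>

lemma linear_extension_prefix_consistent:
  assumes clo: "closed V k I J" and ext: "linear_extension (arc V k I) J \<gamma>" and i: "i \<le> length \<gamma>"
  shows "consistent V k (set (take i \<gamma>))"
proof (rule closed_consistent)
  show "closed V k I (set (take i \<gamma>))"
    unfolding closed_def
  proof (intro allI impI)
    fix Y Z assume arc: "arc V k I Y Z" and Z: "Z \<in> set (take i \<gamma>)"
    have \<gamma>: "distinct \<gamma>" "set \<gamma> = J" "sorted_wrt (\<lambda>y z. \<not> arc V k I z y) \<gamma>"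
      using ext by (auto simp: linear_extension_def)
    have ZJ: "Z \<in> J" using Z \<gamma>(2) by (auto dest: in_set_takeD)
    then have YJ: "Y \<in> J" using clo arc unfolding closed_def by blast
    have "\<not> pos \<gamma> Z < pos \<gamma> Y"
      using \<gamma>(3) arc YJ ZJ unfolding sorted_wrt_iff_pos[OF \<gamma>(1)] \<gamma>(2) by blast
    then show "Y \<in> set (take i \<gamma>)" using Z unfolding in_set_take_iff_pos[OF i] by simp
  qed
qed

text \<open>\<open>pos \<gamma> Y = length \<gamma>\<close> for \<open>Y\<close> not in \<open>\<gamma>\<close>, so the bounds also hold when \<open>J\<close> misses part of the packet.\<close>

lemma pos_between:
  assumes pre: "\<And>i. i \<le> length \<gamma> \<Longrightarrow> consistent V k (set (take i \<gamma>))"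
    and X: "X \<in> nsets V (Suc k)" "a \<in> X" "b \<in> X" "c \<in> X" "a < b" "b < c"
  shows "pos \<gamma> (X - {a}) \<le> pos \<gamma> (X - {b}) \<and> pos \<gamma> (X - {b}) \<le> pos \<gamma> (X - {c})
    \<or> pos \<gamma> (X - {c}) \<le> pos \<gamma> (X - {b}) \<and> pos \<gamma> (X - {b}) \<le> pos \<gamma> (X - {a})"
proof -
  define p where "p x = pos \<gamma> (X - {x})" for x
  have lev: "p b < i \<longleftrightarrow> p a < i" if "i \<le> length \<gamma>" "p a < i \<longleftrightarrow> p c < i" for i
    using consistentD[OF pre[OF that(1)] X] that(2)
    unfolding in_set_take_iff_pos[OF that(1)] p_def by blast
  have le: "p x \<le> length \<gamma>" for x unfolding p_def by (rule pos_le)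
  have "min (p a) (p c) \<le> p b"
    using lev[of "min (p a) (p c)"] le[of a] by linarith
  \<comment> \<open>The prefix of length \<open>min (p a) (p c)\<close> contains neither outer set,
    hence not the middle one. The prefix one longer than the maximum contains both, hence also the
    middle one; if the maximum is \<open>length \<gamma>\<close>, the bound is trivial.\<close>
  moreover have "p b \<le> max (p a) (p c)"
  proof (cases "max (p a) (p c) < length \<gamma>")
    case True
    then show ?thesis using lev[of "Suc (max (p a) (p c))"] by linarith
  next
    case False
    then show ?thesis using le[of b] by linarith
  qed
  ultimately show ?thesis unfolding p_def[symmetric] by linarith
qed

text \<open>Moving the ends of a pair to \<open>Min X\<close> and \<open>Max X\<close> does not
  change its direction under \<open>f\<close>, so all pairs share the direction of the extreme
  pair.\<close>

lemma between_monotone: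
  fixes f :: "'a \<Rightarrow> nat"
  assumes fin: "finite X" and inj: "inj_on f X"
    and bet: "\<And>a b c. a \<in> X \<Longrightarrow> b \<in> X \<Longrightarrow> c \<in> X \<Longrightarrow> a < b \<Longrightarrow> b < c \<Longrightarrow>
      f a \<le> f b \<and> f b \<le> f c \<or> f c \<le> f b \<and> f b \<le> f a"
  shows "(\<forall>a\<in>X. \<forall>b\<in>X. a < b \<longrightarrow> f a < f b) \<or> (\<forall>a\<in>X. \<forall>b\<in>X. a < b \<longrightarrow> f b < f a)"
proof (cases "X = {}")
  case False
  define m M where "m = Min X" and "M = Max X"
  have mM: "m \<in> X" "M \<in> X" "\<And>x. x \<in> X \<Longrightarrow> m = x \<or> m < x" "\<And>x. x \<in> X \<Longrightarrow> x = M \<or> x < M"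
    using fin False Min_in[of X] Max_in[of X] Min_le[OF fin, folded m_def, unfolded le_less]
      Max_ge[OF fin, folded M_def, unfolded le_less] by (auto simp: m_def M_def)
  have ne: "f x \<noteq> f y" if "x \<in> X" "y \<in> X" "x < y" for x y
    using inj_onD[OF inj] that by blast
  have tri: "f a < f b \<and> f b < f c \<or> f c < f b \<and> f b < f a" if "a \<in> X" "b \<in> X" "c \<in> X" "a < b" "b < c" for a b c
    using bet[OF that] ne[of a b] ne[of b c] that by linarith
  have "(f a < f b) = (f m < f M)" if ab: "a \<in> X" "b \<in> X" "a < b" for a b
  proof -
    have 1: "(f m < f b) = (f m < f M)" if "m < b"
      using mM(4)[OF ab(2)] tri[OF mM(1) ab(2) mM(2) that] by auto
    have 2: "(f a < f b) = (f m < f b)"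
      using mM(3)[OF ab(1)] tri[OF mM(1) ab(1,2) _ ab(3)] by auto
    have "m < b" using mM(3)[OF ab(1)] ab(3) by (auto intro: less_trans)
    then show ?thesis using 1 2 by simp
  qed
  then show ?thesis using ne by (metis nat_neq_iff)
qed simp

end

section \<open>Translation of the lexicographic definitions\<close>

text \<open>The lists first differ where \<open>a\<close> stood: one keeps \<open>a\<close>, the
  other has the next larger element there.\<close>

lemma lexord_remove1:
  fixes xs :: "nat list"
  assumes "sorted_wrt (<) xs" "a \<in> set xs" "b \<in> set xs" "a < b"
  shows "(remove1 b xs, remove1 a xs) \<in> lexord {(a, b). a < b}"
  using assms
proof (induction xs)
  case (Cons x xs)
  show ?case
  proof (cases "a = x")
    case True
    then obtain z zs where "xs = z # zs" "x < z" using Cons.prems by (cases xs) auto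
    then show ?thesis using True Cons.prems by auto
  next
    case False
    then have "a \<in> set xs" "b \<in> set xs" "x \<noteq> b" using Cons.prems by auto
    then show ?thesis using Cons False by auto
  qed
qed simp

lemma lex_less_remove:
  assumes "finite X" "a \<in> X" "b \<in> X"
  shows "lex_less (X - {a}) (X - {b}) \<longleftrightarrow> b < a"
proof -
  have asym: "asym (lexord {(a :: nat, b). a < b})" by (rule lexord_asym) (auto intro: asymI)
  have irr: "\<not> lex_less Y Y" for Y
    using asym unfolding lex_less_def by (auto dest: asymD)
  have gt: "lex_less (X - {d}) (X - {c})" if "c \<in> X" "d \<in> X" "c < d" for c d
    using lexord_remove1[of "sorted_list_of_set X" c d] that assms(1)
    by (simp add: lex_less_def sorted_list_of_set_remove)
  show ?thesis
  proof (cases a b rule: linorder_cases)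
    case less
    then have "\<not> lex_less (X - {a}) (X - {b})"
      using gt[of a b] assms asym unfolding lex_less_def by (auto dest: asymD)
    then show ?thesis using less by simp
  qed (use gt[of b a] assms irr in auto)
qed

lemma ksubsets_eq_nsets: "ksubsets n k = nsets {1..n} k"
  by (auto simp: ksubsets_def nsets_def finite_subset)

lemma packet_eq: "X \<in> nsets {1..n} (Suc k) \<Longrightarrow> packet n k X = (\<lambda>a. X - {a}) ` X"
proof (intro set_eqI iffI)
  fix Y assume X: "X \<in> nsets {1..n} (Suc k)" and Y: "Y \<in> packet n k X"
  then have "Y \<subseteq> X" "finite X" "card X = Suc (card Y)"
    by (auto simp: packet_def ksubsets_eq_nsets nsets_def)
  then have "card (X - Y) = 1" by (simp add: card_Diff_subset finite_subset)
  then obtain a where "X - Y = {a}" by (rule card_1_singletonE)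
  then have "a \<in> X" "Y = X - {a}" using \<open>Y \<subseteq> X\<close> by auto
  then show "Y \<in> (\<lambda>a. X - {a}) ` X" by blast
next
  fix Y assume X: "X \<in> nsets {1..n} (Suc k)" and "Y \<in> (\<lambda>a. X - {a}) ` X"
  then show "Y \<in> packet n k X"
    by (auto simp: packet_def ksubsets_eq_nsets nsets_remove)
qed

text \<open>If both monotonicities fail, there are a descent \<open>a < b\<close> and an ascent
  \<open>c < d\<close> of \<open>P\<close>. Then \<open>a\<close>, \<open>b\<close>,
  \<open>d\<close> or \<open>c\<close>, \<open>d\<close>, \<open>b\<close> alternates, according to
  whether \<open>b < d\<close> or \<open>d < b\<close>.\<close>

lemma alternation_cases:
  fixes X :: "nat set"
  shows "(\<forall>a\<in>X. \<forall>b\<in>X. a < b \<longrightarrow> P a \<longrightarrow> P b) \<or> (\<forall>a\<in>X. \<forall>b\<in>X. a < b \<longrightarrow> P b \<longrightarrow> P a)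
    \<longleftrightarrow> (\<forall>a\<in>X. \<forall>b\<in>X. \<forall>c\<in>X. a < b \<longrightarrow> b < c \<longrightarrow> (P a \<longleftrightarrow> P c) \<longrightarrow> (P b \<longleftrightarrow> P a))" (is "?L \<longleftrightarrow> ?R")
proof
  show ?R if ?L using that by blast
next
  assume R: ?R
  show ?L
  proof (rule ccontr)
    assume "\<not> ?L"
    then obtain a b c d where "a \<in> X" "b \<in> X" "a < b" "P a" "\<not> P b" "c \<in> X" "d \<in> X" "c < d" "\<not> P c" "P d"
      by blast
    moreover have "b \<noteq> d" using calculation by blast
    moreover have "c < b" if "d < b" using calculation that by simp
    ultimately show False using R by (metis linorder_neqE_nat)
  qed
qed

lemma lex_prefix_packet:
  assumes "X \<in> nsets {1..n} (Suc k)"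
  shows "lex_prefix (packet n k X \<inter> A) (packet n k X) \<longleftrightarrow> (\<forall>a\<in>X. \<forall>b\<in>X. a < b \<longrightarrow> X - {a} \<in> A \<longrightarrow> X - {b} \<in> A)"
proof -
  have "(\<lambda>a. X - {a}) ` X \<inter> A = (\<lambda>a. X - {a}) ` {a \<in> X. X - {a} \<in> A}" by auto
  moreover have "finite X" using assms by (simp add: nsets_def)
  ultimately show ?thesis
    unfolding lex_prefix_def packet_eq[OF assms] using lex_less_remove[of X] by auto
qed

lemma lex_suffix_packet:
  assumes "X \<in> nsets {1..n} (Suc k)"
  shows "lex_suffix (packet n k X \<inter> A) (packet n k X) \<longleftrightarrow> (\<forall>a\<in>X. \<forall>b\<in>X. a < b \<longrightarrow> X - {b} \<in> A \<longrightarrow> X - {a} \<in> A)"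
proof -
  have "(\<lambda>a. X - {a}) ` X \<inter> A = (\<lambda>a. X - {a}) ` {a \<in> X. X - {a} \<in> A}" by auto
  moreover have "finite X" using assms by (simp add: nsets_def)
  ultimately show ?thesis
    unfolding lex_suffix_def packet_eq[OF assms] using lex_less_remove[of X] by auto
qed

lemma realizable_iff: "realizable n k A \<longleftrightarrow> A \<subseteq> nsets {1..n} k \<and> consistent {1..n} k A"
proof -
  have "lex_prefix (packet n k X \<inter> A) (packet n k X) \<or> lex_suffix (packet n k X \<inter> A) (packet n k X) \<longleftrightarrow>
    (\<forall>a\<in>X. \<forall>b\<in>X. \<forall>c\<in>X. a < b \<longrightarrow> b < c \<longrightarrow> (X - {a} \<in> A \<longleftrightarrow> X - {c} \<in> A) \<longrightarrow> (X - {b} \<in> A \<longleftrightarrow> X - {a} \<in> A))"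
    if "X \<in> nsets {1..n} (Suc k)" for X
    unfolding lex_prefix_packet[OF that] lex_suffix_packet[OF that] by (rule alternation_cases)
  then show ?thesis unfolding realizable_def consistent_def ksubsets_eq_nsets Suc_eq_plus1[symmetric] by auto
qed

lemma full_packets_iff:
  "X \<in> full_packets n k J \<longleftrightarrow> X \<in> nsets {1..n} (Suc k) \<and> (\<forall>a\<in>X. X - {a} \<in> J)"
  unfolding full_packets_def ksubsets_eq_nsets Suc_eq_plus1[symmetric] by (auto simp: packet_eq)

text \<open>A closed \<open>J\<close> fills a packet from the end at which its orientation starts:
  as a suffix if \<open>X\<close> is in \<open>I\<close>, as a prefix otherwise. So all
  \<open>I\<close> for which \<open>J\<close> is closed agree on the partly filled packets.\<close>

lemma suffix_packets_iff:
  assumes clo: "closed {1..n} k I J"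
  shows "X \<in> suffix_packets n k J \<longleftrightarrow>
    X \<in> nsets {1..n} (Suc k) \<and> X \<in> I \<and> (\<exists>a\<in>X. X - {a} \<in> J) \<and> (\<exists>a\<in>X. X - {a} \<notin> J)"
proof (cases "X \<in> nsets {1..n} (Suc k)")
  case True
  have out: "(\<forall>a\<in>X. \<forall>b\<in>X. a < b \<longrightarrow> X - {a} \<in> J \<longrightarrow> X - {b} \<in> J)" if "X \<notin> I"
    using clo arcI2[OF True _ _ _ that] unfolding closed_def by blast
  have inn: "(\<forall>a\<in>X. \<forall>b\<in>X. a < b \<longrightarrow> X - {b} \<in> J \<longrightarrow> X - {a} \<in> J)" if "X \<in> I"
    using clo arcI1[OF True _ _ _ that] unfolding closed_def by blast
  have "False" if "X \<notin> I" "\<forall>a\<in>X. \<forall>b\<in>X. a < b \<longrightarrow> X - {b} \<in> J \<longrightarrow> X - {a} \<in> J" "\<exists>a\<in>X. X - {a} \<in> J" "\<exists>a\<in>X. X - {a} \<notin> J"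
    using that out by (metis linorder_neqE_nat)
  moreover have "X \<in> suffix_packets n k J \<longleftrightarrow> (\<forall>a\<in>X. \<forall>b\<in>X. a < b \<longrightarrow> X - {b} \<in> J \<longrightarrow> X - {a} \<in> J)
     \<and> (\<exists>a\<in>X. X - {a} \<in> J) \<and> (\<exists>a\<in>X. X - {a} \<notin> J)"
    unfolding suffix_packets_def lex_suffix_packet[OF True, symmetric] using True
    by (auto simp: ksubsets_eq_nsets packet_eq)
  ultimately show ?thesis using inn True by blast
next
  case False
  then show ?thesis by (simp add: suffix_packets_def ksubsets_eq_nsets)
qed

lemma paths_iff: "\<gamma> \<in> paths n k J \<longleftrightarrow> distinct \<gamma> \<and> set \<gamma> = J \<and> J \<subseteq> nsets {1..n} k \<and>
   (\<forall>i\<le>length \<gamma>. consistent {1..n} k (set (take i \<gamma>)))"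
proof -
  have "set \<gamma> \<subseteq> nsets {1..n} k"
    if "\<forall>i\<le>length \<gamma>. set (take i \<gamma>) \<subseteq> nsets {1..n} k \<and> consistent {1..n} k (set (take i \<gamma>))"
    using that[rule_format, of "length \<gamma>"] by simp
  then show ?thesis
    unfolding paths_def realizable_iff using set_take_subset[of _ \<gamma>] by blast
qed

text \<open>An arc determines its packet, because the union of its ends is the set from which they
  arise.\<close>

lemma arc_packet:
  assumes "arc V k I Y Z" "Y \<subseteq> X" "Z \<subseteq> X" "X \<in> nsets V (Suc k)"
  shows "\<exists>a\<in>X. \<exists>b\<in>X. a < b \<and> (if X \<in> I then Y = X - {a} \<and> Z = X - {b} else Y = X - {b} \<and> Z = X - {a})"
proof -
  obtain X' a b where X': "X' \<in> nsets V (Suc k)" "a \<in> X'" "b \<in> X'" "a < b"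
    "if X' \<in> I then Y = X' - {a} \<and> Z = X' - {b} else Y = X' - {b} \<and> Z = X' - {a}"
    using assms(1) unfolding arc_def by blast
  have "X' - {a} \<union> (X' - {b}) = X'" using X'(4) by auto
  then have "X' \<subseteq> X" using X'(5) assms(2,3) by (auto split: if_splits)
  then have "X' = X" using X'(1) assms(4) by (intro card_subset_eq) (auto simp: nsets_def)
  then show ?thesis using X' by blast
qed

lemma arc_total_packet:
  assumes "X \<in> nsets V (Suc k)" "a \<in> X" "b \<in> X" "a \<noteq> b"
  shows "arc V k I (X - {a}) (X - {b}) \<or> arc V k I (X - {b}) (X - {a})"
  using assms arcI1[OF assms(1)] arcI2[OF assms(1)] by (metis linorder_neqE)

section \<open>Paths as linear extensions\<close>

lemma linear_extension_in_paths:
  assumes "J \<subseteq> nsets {1..n} k" "closed {1..n} k I J" "linear_extension (arc {1..n} k I) J \<gamma>"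
  shows "\<gamma> \<in> paths n k J"
  unfolding paths_iff using assms linear_extension_prefix_consistent[OF assms(2,3)]
  by (auto simp: linear_extension_def)

lemma inversions_linear_extension:
  assumes "0 < k" "closed {1..n} k I J" and ext: "linear_extension (arc {1..n} k I) J \<gamma>"
  shows "inversions n k J \<gamma> = suffix_packets n k J \<union> (full_packets n k J \<inter> I)"
proof -
  have "sorted_wrt (\<lambda>Y Z. lex_less Z Y) (filter (\<lambda>Y. Y \<in> packet n k X) \<gamma>) \<longleftrightarrow> X \<in> I"
    if full: "X \<in> full_packets n k J" for X
  proof -
    have X: "X \<in> nsets {1..n} (Suc k)" and XJ: "\<And>a. a \<in> X \<Longrightarrow> X - {a} \<in> J"
      using full by (auto simp: full_packets_iff)
    have fin: "finite X" using X by (simp add: nsets_def)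
    have \<gamma>: "distinct \<gamma>" "set \<gamma> = J" "sorted_wrt (\<lambda>y z. \<not> arc {1..n} k I z y) \<gamma>"
      using ext by (auto simp: linear_extension_def)
    let ?f = "filter (\<lambda>Y. Y \<in> packet n k X) \<gamma>"
    have f: "sorted_wrt (\<lambda>y z. \<not> arc {1..n} k I z y) ?f" "set ?f = (\<lambda>a. X - {a}) ` X" "distinct ?f"
      using \<gamma> XJ by (auto simp: sorted_wrt_filter packet_eq[OF X])
    show ?thesis
    proof
      assume anti: "sorted_wrt (\<lambda>Y Z. lex_less Z Y) ?f"
      \<comment> \<open>Two elements of \<open>X\<close> are needed: a packet with a single member
        is antilexicographic under either orientation.\<close>
      have "card X = Suc k" using X by (simp add: nsets_def)
      then obtain a b where ab: "a \<in> X" "b \<in> X" "a < b"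
        using \<open>0 < k\<close> card_le_Suc0_iff_eq[OF fin] by (metis Suc_le_mono le_zero_eq linorder_neqE_nat not_gr0)
      show "X \<in> I"
      proof (rule ccontr)
        assume "X \<notin> I"
        then have arc: "arc {1..n} k I (X - {b}) (X - {a})" using arcI2[OF X ab] by blast
        have neq: "X - {a} \<noteq> X - {b}" using ab by auto
        have "pos ?f (X - {a}) < pos ?f (X - {b}) \<or> pos ?f (X - {b}) < pos ?f (X - {a})"
          using pos_inject[of "X - {a}" ?f "X - {b}"] neq ab f(2) by (metis imageI nat_neq_iff)
        then show False
          using anti f(1) arc lex_less_remove[OF fin, of a b] lex_less_remove[OF fin, of b a] ab
          unfolding sorted_wrt_iff_pos[OF f(3)] f(2) by fastforce
      qed
    next
      assume XI: "X \<in> I"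
      show "sorted_wrt (\<lambda>Y Z. lex_less Z Y) ?f"
        unfolding sorted_wrt_iff_pos[OF f(3)] f(2)
      proof (intro ballI impI)
        fix Y Z assume "Y \<in> (\<lambda>a. X - {a}) ` X" "Z \<in> (\<lambda>a. X - {a}) ` X" and lt: "pos ?f Y < pos ?f Z"
        then obtain a b where ab: "a \<in> X" "b \<in> X" "Y = X - {a}" "Z = X - {b}" by blast
        have "\<not> arc {1..n} k I Z Y"
          using f(1) lt ab unfolding sorted_wrt_iff_pos[OF f(3)] f(2) by blast
        then have "\<not> b < a" using arcI1[OF X ab(2,1) _ XI] ab by blast
        moreover have "a \<noteq> b" using lt ab by auto
        ultimately show "lex_less Z Y" using ab lex_less_remove[OF fin ab(2,1)] by simp
      qed
    qed
  qed
  then show ?thesis unfolding inversions_def by auto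
qed

text \<open>Every path arises as a linear extension, namely for its own inversion set. Its prefixes
  being realizable, each full packet is traversed monotonically and all arcs into \<open>J\<close>
  point forward.\<close>

lemma path_inversions:
  assumes k: "0 < k" and \<gamma>: "\<gamma> \<in> paths n k J"
  shows "consistent {1..n} (Suc k) (inversions n k J \<gamma>)" (is ?con)
    and "closed {1..n} k (inversions n k J \<gamma>) J" (is ?clo)
    and "linear_extension (arc {1..n} k (inversions n k J \<gamma>)) J \<gamma>" (is ?ext)
proof -
  let ?V = "{1..n}"
  define I where "I = inversions n k J \<gamma>"
  have d: "distinct \<gamma>" "set \<gamma> = J" and pre: "\<And>i. i \<le> length \<gamma> \<Longrightarrow> consistent ?V k (set (take i \<gamma>))"
    using \<gamma> unfolding paths_iff by blast+
  have conJ: "consistent ?V k J" using pre[of "length \<gamma>"] d by simp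
  \<comment> \<open>Outside the full packets \<open>I'\<close> agrees with the inversion set: both
    contain the suffix packets and omit the prefix packets and those missed by
    \<open>J\<close>.\<close>
  obtain I' where con': "consistent ?V (Suc k) I'" and clo': "closed ?V k I' J"
    and empty: "\<And>X. X \<in> nsets ?V (Suc k) \<Longrightarrow> \<forall>a\<in>X. X - {a} \<notin> J \<Longrightarrow> X \<notin> I'"
    using exists_inversion_set'[OF conJ] by blast
  define p where "p X a = pos \<gamma> (X - {a})" for X a
  have p_less: "p X a < length \<gamma> \<longleftrightarrow> X - {a} \<in> J" for X a
    unfolding p_def using in_set_iff_pos[of "X - {a}" \<gamma>] d by simp
  have p_le: "p X a \<le> length \<gamma>" for X a unfolding p_def by (rule pos_le)
  have p_eq: "a = b" if "p X a = p X b" "a \<in> X" "b \<in> X" "X - {a} \<in> J" for X a b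
    using that pos_inject[of "X - {a}" \<gamma> "X - {b}"] d unfolding p_def by blast
  have bet: "p X a \<le> p X b \<and> p X b \<le> p X c \<or> p X c \<le> p X b \<and> p X b \<le> p X a"
    if "X \<in> nsets ?V (Suc k)" "a \<in> X" "b \<in> X" "c \<in> X" "a < b" "b < c" for X a b c
    unfolding p_def using pos_between[OF pre that] .
  have nonfull: "X \<in> I \<longleftrightarrow> X \<in> I'" if "X \<in> nsets ?V (Suc k)" "X \<notin> full_packets n k J" for X
    using that suffix_packets_iff[OF clo', of X] empty[of X] unfolding I_def inversions_def
    by (auto simp: full_packets_iff)
  have full: "X \<in> I \<and> (\<forall>a\<in>X. \<forall>b\<in>X. a < b \<longrightarrow> p X a < p X b) \<or> X \<notin> I \<and> (\<forall>a\<in>X. \<forall>b\<in>X. a < b \<longrightarrow> p X b < p X a)"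
    if F: "X \<in> full_packets n k J" for X
  proof -
    have X: "X \<in> nsets ?V (Suc k)" and XJ: "\<And>a. a \<in> X \<Longrightarrow> X - {a} \<in> J"
      using F by (auto simp: full_packets_iff)
    have fin: "finite X" using X by (simp add: nsets_def)
    have "inj_on (p X) X" using p_eq XJ by (intro inj_onI) blast
    then have mono: "(\<forall>a\<in>X. \<forall>b\<in>X. a < b \<longrightarrow> p X a < p X b) \<or> (\<forall>a\<in>X. \<forall>b\<in>X. a < b \<longrightarrow> p X b < p X a)"
      using between_monotone[OF fin] bet[OF X] by blast
    have "X \<notin> suffix_packets n k J" using XJ suffix_packets_iff[OF clo', of X] by blast
    then have "X \<in> I \<longleftrightarrow> sorted_wrt (\<lambda>Y Z. lex_less Z Y) (filter (\<lambda>Y. Y \<in> packet n k X) \<gamma>)"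
      using F by (simp add: I_def inversions_def)
    also have "\<dots> \<longleftrightarrow> (\<forall>Y\<in>J. \<forall>Z\<in>J. pos \<gamma> Y < pos \<gamma> Z \<longrightarrow> Y \<in> packet n k X \<longrightarrow> Z \<in> packet n k X \<longrightarrow> lex_less Z Y)"
      unfolding sorted_wrt_filter_iff sorted_wrt_iff_pos[OF d(1)] d(2) ..
    also have "\<dots> \<longleftrightarrow> (\<forall>a\<in>X. \<forall>b\<in>X. p X a < p X b \<longrightarrow> a < b)"
    proof -
      have "(\<forall>Y\<in>J. \<forall>Z\<in>J. pos \<gamma> Y < pos \<gamma> Z \<longrightarrow> Y \<in> packet n k X \<longrightarrow> Z \<in> packet n k X \<longrightarrow> lex_less Z Y) \<longleftrightarrow>
        (\<forall>Y\<in>packet n k X. \<forall>Z\<in>packet n k X. pos \<gamma> Y < pos \<gamma> Z \<longrightarrow> lex_less Z Y)"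
        using XJ packet_eq[OF X] by auto
      also have "\<dots> \<longleftrightarrow> (\<forall>a\<in>X. \<forall>b\<in>X. p X a < p X b \<longrightarrow> lex_less (X - {b}) (X - {a}))"
        unfolding packet_eq[OF X] p_def by blast
      finally show ?thesis using lex_less_remove[OF fin] by auto
    qed
    finally have inI: "X \<in> I \<longleftrightarrow> (\<forall>a\<in>X. \<forall>b\<in>X. p X a < p X b \<longrightarrow> a < b)" .
    have "card X = Suc k" using X by (simp add: nsets_def)
    then obtain a b where ab: "a \<in> X" "b \<in> X" "a < b"
      using k card_le_Suc0_iff_eq[OF fin] by (metis Suc_le_mono le_zero_eq linorder_neqE_nat not_gr0)
    from mono show ?thesis
    proof
      assume m: "\<forall>a\<in>X. \<forall>b\<in>X. a < b \<longrightarrow> p X a < p X b"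
      have "a < b" if "a \<in> X" "b \<in> X" "p X a < p X b" for a b
        using that m by (cases a b rule: linorder_cases) force+
      then show ?thesis using m inI by blast
    next
      assume m: "\<forall>a\<in>X. \<forall>b\<in>X. a < b \<longrightarrow> p X b < p X a"
      then have "X \<notin> I" using ab inI by (metis less_asym)
      then show ?thesis using m by blast
    qed
  qed
  have arcs: "arc ?V k I Y Z \<Longrightarrow> Z \<in> J \<Longrightarrow> Y \<in> J \<and> pos \<gamma> Y < pos \<gamma> Z" for Y Z
  proof (elim arcE)
    fix X a b
    assume X: "X \<in> nsets ?V (Suc k)" and ab: "a \<in> X" "b \<in> X" "a < b" and XI: "X \<in> I"
      and Y: "Y = X - {a}" and Z: "Z = X - {b}" and ZJ: "Z \<in> J"
    show ?thesis
    proof (cases "X \<in> full_packets n k J")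
      case True
      then show ?thesis using full[OF True] ab XI Y Z by (auto simp: full_packets_iff p_def)
    next
      case False
      have mono: "X - {x} \<in> J" if "x \<in> X" "y \<in> X" "x < y" "X - {y} \<in> J" for x y
        using clo' arcI1[OF X that(1-3), of I'] that(4) nonfull[OF X False] XI unfolding closed_def by blast
      \<comment> \<open>The missing set \<open>X - {c}\<close> has position
        \<open>length \<gamma>\<close>, beyond that of \<open>Z\<close>, which fixes the direction
        in \<open>bet\<close>.\<close>
      obtain c where c: "c \<in> X" "X - {c} \<notin> J" using False X by (auto simp: full_packets_iff)
      have "b < c" using mono[OF c(1) ab(2)] c ZJ Z by (metis linorder_neqE_nat)
      then have "p X a \<le> p X b"
        using bet[OF X ab(1,2) c(1) ab(3)] p_less[of X b] p_less[of X c] p_le[of X c] ZJ c(2) Z by force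
      moreover have "p X a \<noteq> p X b" using p_eq[of X b a] ab Z ZJ by auto
      ultimately show ?thesis using mono[OF ab] ZJ Y Z by (simp add: p_def)
    qed
  next
    fix X a b
    assume X: "X \<in> nsets ?V (Suc k)" and ab: "a \<in> X" "b \<in> X" "a < b" and XI: "X \<notin> I"
      and Y: "Y = X - {b}" and Z: "Z = X - {a}" and ZJ: "Z \<in> J"
    show ?thesis
    proof (cases "X \<in> full_packets n k J")
      case True
      then show ?thesis using full[OF True] ab XI Y Z by (auto simp: full_packets_iff p_def)
    next
      case False
      have mono: "X - {y} \<in> J" if "x \<in> X" "y \<in> X" "x < y" "X - {x} \<in> J" for x y
        using clo' arcI2[OF X that(1-3), of I'] that(4) nonfull[OF X False] XI unfolding closed_def by blast
      obtain c where c: "c \<in> X" "X - {c} \<notin> J" using False X by (auto simp: full_packets_iff)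
      have "c < a" using mono[OF ab(1) c(1)] c ZJ Z by (metis linorder_neqE_nat)
      then have "p X b \<le> p X a"
        using bet[OF X c(1) ab(1,2) _ ab(3)] p_less[of X a] p_less[of X c] p_le[of X c] ZJ c(2) Z by force
      moreover have "p X a \<noteq> p X b" using p_eq[of X a b] ab Z ZJ by auto
      ultimately show ?thesis using mono[OF ab] ZJ Y Z by (simp add: p_def)
    qed
  qed
  have clo: "closed ?V k I J" unfolding closed_def using arcs by blast
  have "linear_extension (arc ?V k I) J \<gamma>"
    unfolding linear_extension_def sorted_wrt_iff_pos[OF d(1)] d(2) using d arcs by (meson less_asym)
  moreover have "consistent ?V (Suc k) I"
    unfolding consistent_def
  proof (intro ballI impI)
    fix W a b c
    assume W: "W \<in> nsets ?V (Suc (Suc k))" "a \<in> W" "b \<in> W" "c \<in> W" and lt: "a < b" "b < c"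
      and e: "(W - {a} \<in> I) = (W - {c} \<in> I)"
    note Wx = nsets_remove[OF W(1)]
    have ac: "a < c" using lt by simp
    have sw: "W - {x} - {y} = W - {y} - {x}" for x y by blast
    have A: "arc ?V k I (W - {x} - {y}) (W - {x} - {z})"
      if "x \<in> W" "y \<in> W" "z \<in> W" "x \<noteq> y" "x \<noteq> z" "y < z \<and> W - {x} \<in> I \<or> z < y \<and> W - {x} \<notin> I" for x y z
      using that arcI1[OF Wx[OF that(1)], of y z I] arcI2[OF Wx[OF that(1)], of z y I] by auto
    show "(W - {b} \<in> I) = (W - {a} \<in> I)"
    proof (rule ccontr)
      assume neq: "(W - {b} \<in> I) \<noteq> (W - {a} \<in> I)"
      \<comment> \<open>An alternation in the packet of \<open>W\<close> makes the three sets below a directed cycle.\<close>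
      have cycle: "(W - {a} \<in> I \<longrightarrow> arc ?V k I (W - {a} - {b}) (W - {a} - {c}) \<and>
          arc ?V k I (W - {a} - {c}) (W - {b} - {c}) \<and> arc ?V k I (W - {b} - {c}) (W - {a} - {b}))
        \<and> (W - {a} \<notin> I \<longrightarrow> arc ?V k I (W - {a} - {c}) (W - {a} - {b}) \<and>
          arc ?V k I (W - {a} - {b}) (W - {b} - {c}) \<and> arc ?V k I (W - {b} - {c}) (W - {a} - {c}))"
        using A[of a b c] A[of a c b] A[of b a c] A[of b c a] A[of c a b] A[of c b a]
          sw[of a b] sw[of a c] sw[of b c] W lt ac neq e by auto
      show False
      proof (cases "W - {a} - {b} \<in> J \<or> W - {a} - {c} \<in> J \<or> W - {b} - {c} \<in> J")
        case True
        \<comment> \<open>One member in \<open>J\<close> pulls the whole cycle into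
          \<open>J\<close>, and positions would increase strictly around it.\<close>
        then show ?thesis using cycle arcs by (meson less_trans less_irrefl)
      next
        case False
        \<comment> \<open>With the cycle outside \<open>J\<close>, none of the three packets is
          full, so the alternation would already occur in \<open>I'\<close>.\<close>
        have nf: "W - {x} \<notin> full_packets n k J" if x: "x \<in> {a, b, c}" for x
        proof -
          consider "x = a" | "x = b" | "x = c" using x by blast
          then have "\<exists>y\<in>W - {x}. W - {x} - {y} \<notin> J"
          proof cases
            case 1
            then show ?thesis using False W lt by (intro bexI[of _ b]) auto
          next
            case 2
            then show ?thesis using False W lt sw[of a b] by (intro bexI[of _ a]) auto
          next
            case 3
            then show ?thesis using False W lt sw[of a c] by (intro bexI[of _ a]) auto
          qed
          then show ?thesis by (auto simp: full_packets_iff)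
        qed
        have "W - {x} \<in> I \<longleftrightarrow> W - {x} \<in> I'" if "x \<in> {a, b, c}" for x
          using that nonfull[OF Wx nf[OF that]] W by blast
        then show ?thesis using consistentD[OF con' W lt] e neq by simp
      qed
    qed
  qed
  ultimately show ?con ?clo ?ext using clo unfolding I_def by blast+
qed

section \<open>Classes are determined by their inversion sets\<close>

lemma inversions_bounds:
  "suffix_packets n k J \<subseteq> inversions n k J \<gamma>"
  "inversions n k J \<gamma> \<subseteq> suffix_packets n k J \<union> full_packets n k J"
  by (auto simp: inversions_def)

lemma suffix_not_full: "X \<in> suffix_packets n k J \<Longrightarrow> X \<notin> full_packets n k J"
  unfolding suffix_packets_def full_packets_def by auto

text \<open>Both paths are linear extensions of one relation and hence joined by swaps of unrelated
  neighbours. Two distinct members of a common packet are always related, so these swaps are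
  elementary equivalences.\<close>

lemma path_equiv_if_inversions_eq:
  assumes k: "0 < k" and \<gamma>: "\<gamma> \<in> paths n k J" and \<gamma>': "\<gamma>' \<in> paths n k J"
    and eq: "inversions n k J \<gamma> = inversions n k J \<gamma>'"
  shows "(\<gamma>, \<gamma>') \<in> path_equiv n k J"
proof -
  define R where "R = arc {1..n} k (inversions n k J \<gamma>)"
  have J: "J \<subseteq> nsets {1..n} k" using \<gamma> unfolding paths_iff by blast
  note clo = path_inversions(2)[OF k \<gamma>]
  have ext: "linear_extension R J \<gamma>" "linear_extension R J \<gamma>'"
    using path_inversions(3)[OF k \<gamma>] path_inversions(3)[OF k \<gamma>'] eq by (simp_all add: R_def)
  have path: "\<delta> \<in> paths n k J" if "linear_extension R J \<delta>" for \<delta>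
    using linear_extension_in_paths[OF J clo] that by (simp add: R_def)
  have elem: "elem_equiv n k J \<delta> \<delta>'" if sw: "swap_step R \<delta> \<delta>'" and \<delta>: "linear_extension R J \<delta>" for \<delta> \<delta>'
  proof -
    obtain us Y Z vs where dd: "\<delta> = us @ [Y, Z] @ vs" "\<delta>' = us @ [Z, Y] @ vs" and nR: "\<not> R Y Z" "\<not> R Z Y"
      using sw unfolding swap_step_def by blast
    have "Y \<noteq> Z" using \<delta> dd by (auto simp: linear_extension_def)
    moreover have "\<exists>a\<in>X. \<exists>b\<in>X. Y = X - {a} \<and> Z = X - {b}"
      if "X \<in> nsets {1..n} (Suc k)" "Y \<in> packet n k X" "Z \<in> packet n k X" for X
      using that by (auto simp: packet_eq)
    ultimately have "\<not> (\<exists>X\<in>ksubsets n (k + 1). Y \<in> packet n k X \<and> Z \<in> packet n k X)"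
      using nR arc_total_packet unfolding R_def ksubsets_eq_nsets Suc_eq_plus1[symmetric] by metis
    then show ?thesis
      unfolding elem_equiv_def using dd path[OF \<delta>] path[OF swap_step_linear_extension[OF sw \<delta>]] by blast
  qed
  have "linear_extension R J \<delta> \<and> equivclp (elem_equiv n k J) \<gamma> \<delta>" if "(swap_step R)\<^sup>*\<^sup>* \<gamma> \<delta>" for \<delta>
    using that
  proof (induction rule: rtranclp_induct)
    case base
    then show ?case using ext by simp
  next
    case (step \<delta> \<delta>')
    then have "elem_equiv n k J \<delta> \<delta>'" by (intro elem) simp_all
    then have "equivclp (elem_equiv n k J) \<gamma> \<delta>'"
      using step.IH by (blast intro: equivclp_trans r_into_equivclp)
    then show ?case using step swap_step_linear_extension by blast
  qed
  then show ?thesis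
    using linear_extensions_connected[OF ext] \<gamma> \<gamma>' by (simp add: path_equiv_def)
qed

lemma path_class:
  assumes "\<gamma> \<in> paths n k J"
  shows "path_equiv n k J `` {\<gamma>} \<in> path_classes n k J" "\<gamma> \<in> path_equiv n k J `` {\<gamma>}"
    "class_inversions n k J (path_equiv n k J `` {\<gamma>}) = inversions n k J \<gamma>"
proof -
  show 1: "path_equiv n k J `` {\<gamma>} \<in> path_classes n k J"
    unfolding path_classes_def using assms by (rule quotientI)
  show 2: "\<gamma> \<in> path_equiv n k J `` {\<gamma>}"
    using equiv_class_self[OF equiv_path_equiv assms] .
  show "class_inversions n k J (path_equiv n k J `` {\<gamma>}) = inversions n k J \<gamma>"
    by (rule class_inversions_eq[OF 1 2])
qed

lemma path_class_eq:
  assumes "0 < k" "r \<in> path_classes n k J" "\<gamma> \<in> paths n k J"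
    and "class_inversions n k J r = inversions n k J \<gamma>"
  shows "r = path_equiv n k J `` {\<gamma>}"
proof -
  obtain \<delta> where \<delta>: "\<delta> \<in> paths n k J" "r = path_equiv n k J `` {\<delta>}"
    using assms(2) unfolding path_classes_def by (blast elim: quotientE)
  then have "inversions n k J \<delta> = inversions n k J \<gamma>" using path_class(3)[OF \<delta>(1)] assms(4) by simp
  then show ?thesis
    using path_equiv_if_inversions_eq[OF assms(1) \<delta>(1) assms(3)] equiv_class_eq[OF equiv_path_equiv] \<delta>(2) by metis
qed

lemma class_inversions_inject:
  assumes "0 < k" "r \<in> path_classes n k J" "r' \<in> path_classes n k J"
    and "class_inversions n k J r = class_inversions n k J r'"
  shows "r = r'"
proof -
  obtain \<delta> where \<delta>: "\<delta> \<in> paths n k J" "r' = path_equiv n k J `` {\<delta>}"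
    using assms(3) unfolding path_classes_def by (blast elim: quotientE)
  then show ?thesis using path_class_eq[OF assms(1,2) \<delta>(1)] path_class(3)[OF \<delta>(1)] assms(4) by simp
qed

section \<open>Flips and the partial order\<close>

lemma rev_eq_if_singleton:
  assumes "distinct xs" "\<And>y z. y \<in> set xs \<Longrightarrow> z \<in> set xs \<Longrightarrow> y = z"
  shows "rev xs = xs"
proof (cases xs)
  case (Cons x xs')
  have "xs' = []"
  proof (cases xs')
    case (Cons y ys)
    then have "x = y" using \<open>xs = x # xs'\<close> by (intro assms(2)) simp_all
    then show ?thesis using assms(1) \<open>xs = x # xs'\<close> Cons by simp
  qed
  then show ?thesis using Cons by simp
qed simp

text \<open>Distinct packets share at most one set, since two sets determine \<open>X\<close> as
  their union. Reversing the block thus changes the order inside no other packet, and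
  \<open>X\<close> itself was no inversion before.\<close>

lemma flip_inversions_mono:
  assumes flip: "flip n k J X r r'" and X: "X \<notin> class_inversions n k J r"
  shows "class_inversions n k J r \<subseteq> class_inversions n k J r'"
proof -
  obtain xs bs ys where r: "xs @ bs @ ys \<in> r" "r \<in> path_classes n k J"
    and r': "xs @ rev bs @ ys \<in> r'" "r' \<in> path_classes n k J" and bs: "set bs = packet n k X"
    and full: "X \<in> full_packets n k J"
    using flip unfolding flip_def by blast
  have "xs @ bs @ ys \<in> paths n k J"
    using r in_quotient_imp_subset[OF equiv_path_equiv] unfolding path_classes_def by blast
  then have dist: "distinct bs" by (simp add: paths_def)
  have X1: "X \<in> nsets {1..n} (Suc k)" using full by (simp add: full_packets_iff)
  have filt: "filter (\<lambda>Y. Y \<in> packet n k X') (rev bs) = filter (\<lambda>Y. Y \<in> packet n k X') bs"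
    if "X' \<in> full_packets n k J" "X' \<noteq> X" for X'
  proof -
    have X': "X' \<in> nsets {1..n} (Suc k)" using that by (simp add: full_packets_iff)
    have "Y = Z" if YZ: "Y \<in> packet n k X" "Z \<in> packet n k X" "Y \<in> packet n k X'" "Z \<in> packet n k X'" for Y Z
    proof (rule ccontr)
      assume "Y \<noteq> Z"
      then have "Y \<union> Z = X" "Y \<union> Z = X'"
        using YZ unfolding packet_eq[OF X1] packet_eq[OF X'] by auto
      then show False using \<open>X' \<noteq> X\<close> by simp
    qed
    then have "rev (filter (\<lambda>Y. Y \<in> packet n k X') bs) = filter (\<lambda>Y. Y \<in> packet n k X') bs"
      using dist bs by (intro rev_eq_if_singleton) auto
    then show ?thesis by (simp add: rev_filter)
  qed
  have "filter (\<lambda>Y. Y \<in> packet n k X') (xs @ rev bs @ ys) = filter (\<lambda>Y. Y \<in> packet n k X') (xs @ bs @ ys)"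
    if "X' \<in> full_packets n k J" "X' \<noteq> X" for X'
    using filt[OF that] by (simp only: filter_append)
  note filt' = this
  have "inversions n k J (xs @ bs @ ys) - {X} \<subseteq> inversions n k J (xs @ rev bs @ ys)"
  proof
    fix X' assume X': "X' \<in> inversions n k J (xs @ bs @ ys) - {X}"
    show "X' \<in> inversions n k J (xs @ rev bs @ ys)"
    proof (cases "X' \<in> full_packets n k J")
      case True
      then show ?thesis using X' filt'[OF True] unfolding inversions_def by (simp del: filter_append)
    next
      case False
      then show ?thesis using X' by (simp add: inversions_def)
    qed
  qed
  then show ?thesis
    using X class_inversions_eq[OF r(2,1)] class_inversions_eq[OF r'(2,1)] by blast
qed

lemma ms_order_mono:
  assumes "(r, r') \<in> ms_order n k J"
  shows "class_inversions n k J r \<subseteq> class_inversions n k J r'"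
proof -
  have "(\<lambda>s s'. \<exists>X. flip n k J X s s' \<and> X \<notin> class_inversions n k J s)\<^sup>*\<^sup>* r r'"
    using assms by (simp add: ms_order_def)
  then show ?thesis
    by (induction rule: rtranclp_induct) (auto dest: flip_inversions_mono)
qed

text \<open>For antisymmetry, inversion sets only grow along flips, so mutually reachable classes
  have equal inversion sets and coincide.\<close>

lemma partial_order_ms_order:
  assumes "0 < k"
  shows "partial_order_on (path_classes n k J) (ms_order n k J)"
proof -
  have "antisym (ms_order n k J)"
  proof (rule antisymI)
    fix r r' assume rr: "(r, r') \<in> ms_order n k J" "(r', r) \<in> ms_order n k J"
    then have "class_inversions n k J r = class_inversions n k J r'"
      by (intro equalityI ms_order_mono)
    then show "r = r'"
      using rr(1) by (intro class_inversions_inject[OF assms]) (simp_all add: ms_order_def)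
  qed
  moreover have "trans (ms_order n k J)"
    by (auto simp: ms_order_def intro!: transI intro: rtranclp_trans)
  moreover have "refl_on (path_classes n k J) (ms_order n k J)" "ms_order n k J \<subseteq> path_classes n k J \<times> path_classes n k J"
    by (auto simp: ms_order_def refl_on_def)
  ultimately show ?thesis by (simp add: partial_order_on_def preorder_on_def)
qed

section \<open>Existence of flips\<close>

lemma arc_outside_packet:
  assumes X: "X \<in> nsets {1..n} (Suc k)" and arc: "arc {1..n} k I Y Z"
    and out: "\<not> (Y \<in> packet n k X \<and> Z \<in> packet n k X)"
    and I': "\<And>X'. X' \<noteq> X \<Longrightarrow> X' \<in> I \<longleftrightarrow> X' \<in> I'"
  shows "arc {1..n} k I' Y Z"
  using arc
proof (cases rule: arcE)
  case (1 X' a b)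
  then have "X' \<noteq> X" using out packet_eq[OF X] by blast
  then show ?thesis using 1 I' arcI1[OF 1(1-4)] by simp
next
  case (2 X' a b)
  then have "X' \<noteq> X" using out packet_eq[OF X] by blast
  then show ?thesis using 2 I' arcI2[OF 2(1-4)] by simp
qed

text \<open>The arcs of \<open>I\<close> and of \<open>insert X I\<close> agree off the packet of
  \<open>X\<close>, are opposite on it, and are acyclic for both sets, so
  \<open>contiguous_block\<close> applies.\<close>

lemma flip_exists:
  assumes k: "0 < k" and J: "J \<subseteq> nsets {1..n} k" and X: "X \<in> full_packets n k J" "X \<notin> I"
    and con: "consistent {1..n} (Suc k) I" "consistent {1..n} (Suc k) (insert X I)"
    and clo: "closed {1..n} k I J"
  shows "\<exists>\<gamma>\<in>paths n k J. \<exists>\<gamma>'\<in>paths n k J.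
    flip n k J X (path_equiv n k J `` {\<gamma>}) (path_equiv n k J `` {\<gamma>'}) \<and>
    inversions n k J \<gamma> = suffix_packets n k J \<union> full_packets n k J \<inter> I \<and>
    inversions n k J \<gamma>' = suffix_packets n k J \<union> full_packets n k J \<inter> insert X I"
proof -
  let ?V = "{1..n}" and ?P = "packet n k X"
  have X1: "X \<in> nsets ?V (Suc k)" and XJ: "\<And>a. a \<in> X \<Longrightarrow> X - {a} \<in> J"
    using X(1) by (auto simp: full_packets_iff)
  have finV: "finite ?V" by simp
  obtain \<rho> :: "nat set \<Rightarrow> nat" where \<rho>: "\<And>Y Z. arc ?V k I Y Z \<Longrightarrow> \<rho> Y < \<rho> Z"
    using arc_rank[OF finV con(1)] by blast
  obtain \<rho>' :: "nat set \<Rightarrow> nat" where \<rho>': "\<And>Y Z. arc ?V k (insert X I) Y Z \<Longrightarrow> \<rho>' Y < \<rho>' Z"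
    using arc_rank[OF finV con(2)] by blast
  have Psub: "Y \<subseteq> X" if "Y \<in> ?P" for Y using that by (auto simp: packet_def)
  have out: "arc ?V k I Y Z \<longleftrightarrow> arc ?V k (insert X I) Y Z" if "\<not> (Y \<in> ?P \<and> Z \<in> ?P)" for Y Z
    using arc_outside_packet[OF X1 _ that, of I "insert X I"] arc_outside_packet[OF X1 _ that, of "insert X I" I] by blast
  have rev: "arc ?V k I Y Z \<longleftrightarrow> arc ?V k (insert X I) Z Y" if P: "Y \<in> ?P" "Z \<in> ?P" for Y Z
  proof
    assume arc: "arc ?V k I Y Z"
    obtain a b where "a \<in> X" "b \<in> X" "a < b" "Y = X - {b}" "Z = X - {a}"
      using arc_packet[OF arc Psub[OF P(1)] Psub[OF P(2)] X1] X(2) by auto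
    then show "arc ?V k (insert X I) Z Y" using arcI1[OF X1] by blast
  next
    assume arc: "arc ?V k (insert X I) Z Y"
    obtain a b where "a \<in> X" "b \<in> X" "a < b" "Z = X - {a}" "Y = X - {b}"
      using arc_packet[OF arc Psub[OF P(2)] Psub[OF P(1)] X1] by auto
    then show "arc ?V k I Y Z" using arcI2[OF X1 _ _ _ X(2)] by blast
  qed
  have clo': "closed ?V k (insert X I) J"
    unfolding closed_def
  proof (intro allI impI)
    fix Y Z assume arc: "arc ?V k (insert X I) Y Z" and Z: "Z \<in> J"
    show "Y \<in> J"
    proof (cases "Y \<in> ?P")
      case True
      then show ?thesis using XJ by (auto simp: packet_eq[OF X1])
    next
      case False
      then have "\<not> (Y \<in> ?P \<and> Z \<in> ?P)" by blast
      with arc have "arc ?V k I Y Z" using out by blast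
      then show ?thesis using clo Z unfolding closed_def by blast
    qed
  qed
  have finJ: "finite J" using J by (rule finite_subset) (simp add: finite_imp_finite_nsets)
  have PJ: "?P \<subseteq> J" using XJ by (auto simp: packet_eq[OF X1])
  have tot: "arc ?V k I Y Z \<or> arc ?V k I Z Y" if "Y \<in> ?P" "Z \<in> ?P" "Y \<noteq> Z" for Y Z
    using that arc_total_packet[OF X1] unfolding packet_eq[OF X1] by blast
  obtain xs bs ys where ext: "linear_extension (arc ?V k I) J (xs @ bs @ ys)" and bs: "set bs = ?P"
    and ext': "linear_extension (arc ?V k (insert X I)) J (xs @ rev bs @ ys)"
    using contiguous_block[of J ?P "arc ?V k I" \<rho> "arc ?V k (insert X I)" \<rho>', OF finJ PJ \<rho> \<rho>' out rev tot] by blast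
  have p: "xs @ bs @ ys \<in> paths n k J" "xs @ rev bs @ ys \<in> paths n k J"
    using linear_extension_in_paths[OF J clo ext] linear_extension_in_paths[OF J clo' ext'] .
  have "flip n k J X (path_equiv n k J `` {xs @ bs @ ys}) (path_equiv n k J `` {xs @ rev bs @ ys})"
    unfolding flip_def using X(1) path_class(1,2)[OF p(1)] path_class(1,2)[OF p(2)] bs by blast
  then show ?thesis
    using p inversions_linear_extension[OF k clo ext] inversions_linear_extension[OF k clo' ext'] by blast
qed

lemma ms_order_flip:
  assumes "flip n k J X r r'" "X \<notin> class_inversions n k J r"
  shows "(r, r') \<in> ms_order n k J"
proof -
  have "(\<lambda>s s'. \<exists>X. flip n k J X s s' \<and> X \<notin> class_inversions n k J s) r r'" using assms by blast
  moreover have "r \<in> path_classes n k J" "r' \<in> path_classes n k J" using assms(1) by (simp_all add: flip_def)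
  ultimately show ?thesis unfolding ms_order_def by (simp add: r_into_rtranclp)
qed

lemma flip_down_exists:
  assumes k: "0 < k" and r: "r \<in> path_classes n k J" and X0: "X0 \<in> class_inversions n k J r" "X0 \<in> full_packets n k J"
  shows "\<exists>r'\<in>path_classes n k J. (r', r) \<in> ms_order n k J \<and> r' \<noteq> r"
proof -
  obtain \<delta> where \<delta>: "\<delta> \<in> paths n k J" "r = path_equiv n k J `` {\<delta>}"
    using r unfolding path_classes_def by (blast elim: quotientE)
  define I where "I = inversions n k J \<delta>"
  have J: "J \<subseteq> nsets {1..n} k" using \<delta> unfolding paths_iff by blast
  have rI: "class_inversions n k J r = I" using path_class(3)[OF \<delta>(1)] \<delta>(2) by (simp add: I_def)
  have con: "consistent {1..n} (Suc k) I" and clo: "closed {1..n} k I J"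
    using path_inversions[OF k \<delta>(1)] by (simp_all add: I_def)
  obtain X where X: "X \<in> nsets {1..n} (Suc k)" "X \<in> I" "\<forall>a\<in>X. X - {a} \<in> J"
    and con': "consistent {1..n} (Suc k) (I - {X})"
    using flip_down[OF _ con clo, of X0] X0 rI by (auto simp: full_packets_iff)
  have full: "X \<in> full_packets n k J" using X by (simp add: full_packets_iff)
  have clo': "closed {1..n} k (I - {X}) J"
    unfolding closed_def
  proof (intro allI impI)
    fix Y Z assume arc: "arc {1..n} k (I - {X}) Y Z" and Z: "Z \<in> J"
    show "Y \<in> J"
    proof (cases "Y \<in> packet n k X")
      case True
      then show ?thesis using X(1,3) by (auto simp: packet_eq)
    next
      case False
      then have "arc {1..n} k I Y Z"
        using arc_outside_packet[OF X(1) arc, of I] by blast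
      then show ?thesis using clo Z unfolding closed_def by blast
    qed
  qed
  have ins: "insert X (I - {X}) = I" using X(2) by blast
  obtain \<gamma> \<gamma>' where p: "\<gamma> \<in> paths n k J" "\<gamma>' \<in> paths n k J"
    and flip: "flip n k J X (path_equiv n k J `` {\<gamma>}) (path_equiv n k J `` {\<gamma>'})"
    and inv: "inversions n k J \<gamma> = suffix_packets n k J \<union> full_packets n k J \<inter> (I - {X})"
      "inversions n k J \<gamma>' = suffix_packets n k J \<union> full_packets n k J \<inter> I"
    using flip_exists[OF k J full _ con' _ clo'] con unfolding ins by blast
  \<comment> \<open>An inversion set contains \<open>J\<^sub>s\<close> and lies inside
    \<open>J\<^sub>s \<union> J\<^sub>F\<close>, so it is recovered from its trace on
    \<open>J\<^sub>F\<close>.\<close>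
  have "inversions n k J \<gamma>' = I" using inv(2) inversions_bounds[of n k J \<delta>] unfolding I_def by blast
  then have "path_equiv n k J `` {\<gamma>'} = r" using path_class_eq[OF k r p(2)] rI by simp
  moreover have "X \<notin> inversions n k J \<gamma>" using inv(1) suffix_not_full full by blast
  ultimately show ?thesis
    using ms_order_flip[OF flip] path_class[OF p(1)] X(2) rI by metis
qed

lemma flip_up_exists:
  assumes k: "0 < k" and r: "r \<in> path_classes n k J" and X0: "X0 \<notin> class_inversions n k J r" "X0 \<in> full_packets n k J"
  shows "\<exists>r'\<in>path_classes n k J. (r, r') \<in> ms_order n k J \<and> r' \<noteq> r"
proof -
  obtain \<delta> where \<delta>: "\<delta> \<in> paths n k J" "r = path_equiv n k J `` {\<delta>}"
    using r unfolding path_classes_def by (blast elim: quotientE)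
  define I where "I = inversions n k J \<delta>"
  have J: "J \<subseteq> nsets {1..n} k" using \<delta> unfolding paths_iff by blast
  have rI: "class_inversions n k J r = I" using path_class(3)[OF \<delta>(1)] \<delta>(2) by (simp add: I_def)
  have con: "consistent {1..n} (Suc k) I" and clo: "closed {1..n} k I J"
    using path_inversions[OF k \<delta>(1)] by (simp_all add: I_def)
  obtain X where X: "X \<in> nsets {1..n} (Suc k)" "X \<notin> I" "\<forall>a\<in>X. X - {a} \<in> J"
    and con': "consistent {1..n} (Suc k) (insert X I)"
    using flip_up[OF _ con clo, of X0] X0 rI by (auto simp: full_packets_iff)
  have full: "X \<in> full_packets n k J" using X by (simp add: full_packets_iff)
  obtain \<gamma> \<gamma>' where p: "\<gamma> \<in> paths n k J" "\<gamma>' \<in> paths n k J"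
    and flip: "flip n k J X (path_equiv n k J `` {\<gamma>}) (path_equiv n k J `` {\<gamma>'})"
    and inv: "inversions n k J \<gamma> = suffix_packets n k J \<union> full_packets n k J \<inter> I"
      "inversions n k J \<gamma>' = suffix_packets n k J \<union> full_packets n k J \<inter> insert X I"
    using flip_exists[OF k J full X(2) con con' clo] by blast
  have "inversions n k J \<gamma> = I" using inv(1) inversions_bounds[of n k J \<delta>] unfolding I_def by blast
  then have "path_equiv n k J `` {\<gamma>} = r" using path_class_eq[OF k r p(1)] rI by simp
  moreover have "X \<in> inversions n k J \<gamma>'" using inv(2) full by blast
  ultimately show ?thesis
    using ms_order_flip[OF flip] path_class[OF p(2)] X(2) rI by metis
qed

section \<open>The extremal classes\<close>

lemma class_exists:
  assumes k: "0 < k" and J: "J \<subseteq> nsets {1..n} k" and con: "consistent {1..n} (Suc k) I" and clo: "closed {1..n} k I J"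
  shows "\<exists>r\<in>path_classes n k J. class_inversions n k J r = suffix_packets n k J \<union> full_packets n k J \<inter> I"
proof -
  obtain \<rho> :: "nat set \<Rightarrow> nat" where \<rho>: "\<And>Y Z. arc {1..n} k I Y Z \<Longrightarrow> \<rho> Y < \<rho> Z"
    using arc_rank[OF _ con] by blast
  have "finite J" using J by (rule finite_subset) (simp add: finite_imp_finite_nsets)
  then obtain \<gamma> where ext: "linear_extension (arc {1..n} k I) J \<gamma>"
    using linear_extension_exists[of J "arc {1..n} k I" \<rho>] \<rho> by blast
  then show ?thesis
    using path_class[OF linear_extension_in_paths[OF J clo ext]] inversions_linear_extension[OF k clo ext] by metis
qed

lemma class_inversions_bounds:
  assumes "r \<in> path_classes n k J"
  shows "suffix_packets n k J \<subseteq> class_inversions n k J r"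
    "class_inversions n k J r \<subseteq> suffix_packets n k J \<union> full_packets n k J"
proof -
  obtain \<gamma> where \<gamma>: "\<gamma> \<in> paths n k J" "r = path_equiv n k J `` {\<gamma>}"
    using assms unfolding path_classes_def by (blast elim: quotientE)
  have "class_inversions n k J r = inversions n k J \<gamma>" using path_class(3)[OF \<gamma>(1)] \<gamma>(2) by simp
  then show "suffix_packets n k J \<subseteq> class_inversions n k J r"
    "class_inversions n k J r \<subseteq> suffix_packets n k J \<union> full_packets n k J"
    using inversions_bounds[of n k J \<gamma>] by simp_all
qed

theorem theorem3p24:
  fixes n k :: nat and J :: "nat set set"
  assumes "1 < k" and "k \<le> n"
    and "J \<subseteq> ksubsets n k" and "realizable n k J"
  shows "partial_order_on (path_classes n k J) (ms_order n k J) \<and>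
    (\<exists>r_min r_max.
       minimal_elements (path_classes n k J) (ms_order n k J) = {r_min} \<and>
       maximal_elements (path_classes n k J) (ms_order n k J) = {r_max} \<and>
       class_inversions n k J r_min = suffix_packets n k J \<and>
       class_inversions n k J r_max = suffix_packets n k J \<union> full_packets n k J \<and>
       (\<forall>r\<in>path_classes n k J.
          class_inversions n k J r = class_inversions n k J r_min \<longrightarrow> r = r_min) \<and>
       (\<forall>r\<in>path_classes n k J.
          class_inversions n k J r = class_inversions n k J r_max \<longrightarrow> r = r_max))"
proof -
  have k: "0 < k" using assms(1) by simp
  let ?P = "path_classes n k J" and ?inv = "class_inversions n k J"
  let ?S = "suffix_packets n k J" and ?F = "full_packets n k J"
  have J: "J \<subseteq> nsets {1..n} k" and con: "consistent {1..n} k J"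
    using assms(4) by (auto simp: realizable_iff)
  obtain I where "consistent {1..n} (Suc k) I" "closed {1..n} k I J" "?F \<inter> I = {}"
    using exists_inversion_set[OF con] full_packets_iff by fast
  then have "\<exists>r\<in>?P. ?inv r = ?S" using class_exists[OF k J, of I] by simp
  then obtain r_min where rmin: "r_min \<in> ?P" "?inv r_min = ?S" by blast
  obtain I' where "consistent {1..n} (Suc k) I'" "closed {1..n} k I' J" "?F \<subseteq> I'"
    using exists_inversion_set'[OF con] full_packets_iff by fast
  then have "\<exists>r\<in>?P. ?inv r = ?S \<union> ?F" using class_exists[OF k J, of I'] by (simp add: Int_absorb2)
  then obtain r_max where rmax: "r_max \<in> ?P" "?inv r_max = ?S \<union> ?F" by blast
  note inject = class_inversions_inject[OF k]
  \<comment> \<open>Below \<open>r_min\<close> inversion sets shrink, yet they always contain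
    \<open>J\<^sub>s\<close>; equal inversion sets mean equal classes.\<close>
  have "r = r_min" if "r \<in> ?P" "(r, r_min) \<in> ms_order n k J" for r
    using that ms_order_mono[OF that(2)] class_inversions_bounds(1)[OF that(1)] rmin inject[of r n J r_min] by blast
  moreover have "r = r_min" if r: "r \<in> ?P" and min: "\<And>x. x \<in> ?P \<Longrightarrow> (x, r) \<in> ms_order n k J \<Longrightarrow> x = r" for r
  proof -
    \<comment> \<open>An inversion in a full packet would allow a downward flip to a different
      class. So a minimal class has inversion set \<open>J\<^sub>s\<close>.\<close>
    have "?inv r \<inter> ?F = {}" using flip_down_exists[OF k r] min by blast
    then show ?thesis using class_inversions_bounds[OF r] rmin inject[of r n J r_min] r by blast
  qed
  ultimately have minimal: "minimal_elements ?P (ms_order n k J) = {r_min}"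
    using rmin(1) unfolding minimal_elements_def by blast
  have "r = r_max" if "r \<in> ?P" "(r_max, r) \<in> ms_order n k J" for r
    using that ms_order_mono[OF that(2)] class_inversions_bounds(2)[OF that(1)] rmax inject[of r n J r_max] by blast
  moreover have "r = r_max" if r: "r \<in> ?P" and max: "\<And>x. x \<in> ?P \<Longrightarrow> (r, x) \<in> ms_order n k J \<Longrightarrow> x = r" for r
  proof -
    have "?F \<subseteq> ?inv r" using flip_up_exists[OF k r] max by blast
    then show ?thesis using class_inversions_bounds[OF r] rmax inject[of r n J r_max] r by blast
  qed
  ultimately have maximal: "maximal_elements ?P (ms_order n k J) = {r_max}"
    using rmax(1) unfolding maximal_elements_def by blast
  show ?thesis
  proof (intro conjI exI)
    show "partial_order_on ?P (ms_order n k J)" using k by (rule partial_order_ms_order)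
    show "\<forall>r\<in>?P. ?inv r = ?inv r_min \<longrightarrow> r = r_min" "\<forall>r\<in>?P. ?inv r = ?inv r_max \<longrightarrow> r = r_max"
      using inject rmin(1) rmax(1) by blast+
  qed (fact minimal maximal rmin(2) rmax(2))+
qed

end
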